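(* Suppose that $W_d$, $d\geq4$, is a geodesic $d$-web given on a surface $(M,g)$ of constant curvature, with web functions $f_1,\dots,f_d$, for which the $d-4$ additional second-order invariants $$\Pi_{22}^1f_{j,1}^3-3\Pi_{12}^1f_{j,1}^2f_{j,2}-3\Pi_{12}^2f_{j,1}f_{j,2}^2+\Pi_{11}^2f_{j,2}^3-\operatorname{Flex} f_j,\qquad j=5,\dots,d,$$ vanish. Then any mapping of $W_d$ on a geodesic web $\widetilde W_d$ is a projective transformation.
   Context: A $d$-web on a surface is given by $d$ foliations by curves in general position, which in local coordinates $(x,y)$ are the level sets of smooth web functions $f_1,\dots,f_d$. A $d$-web is geodesic if all its leaves are geodesics of a torsion-free affine connection; for the web $W_d$ on $(M,g)$ this is the Levi-Civita connection of $g$. Notation: $f_{j,1}=\partial f_j/\partial x$, $f_{j,2}=\partial f_j/\partial y$, $\operatorname{Flex} f=f_y^2f_{xx}-2f_xf_yf_{xy}+f_x^2f_{yy}$, and $\Pi^1_{22},\Pi^1_{12},\Pi^2_{12},\Pi^2_{11}$ are the functions uniquely determined by the $4$-subweb $f_1,\dots,f_4$ through the linear system $\Pi_{22}^1f_{i,1}^3-3\Pi_{12}^1f_{i,1}^2f_{i,2}-3\Pi_{12}^2f_{i,1}f_{i,2}^2+\Pi_{11}^2f_{i,2}^3=\operatorname{Flex} f_i$, $i=1,2,3,4$ (for $d=4$ there are no additional invariants). A projective structure is a class of projectively equivalent affine connections, where $\nabla$ and $\widetilde\nabla$ are projectively equivalent if $\nabla_XY-\widetilde\nabla_XY=\rho(X)Y+\rho(Y)X$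 for some differential $1$-form $\rho$ and all vector fields $X,Y$. A geodesic $d$-web with $d\ge4$ determines a unique projective structure for which its leaves are geodesics. A mapping of $W_d$ on $\widetilde W_d$ is a (local) diffeomorphism carrying the foliations of $W_d$ to those of $\widetilde W_d$; it is a projective transformation if it carries the projective structure determined by $W_d$ to the one determined by $\widetilde W_d$. *)

theory Defs
  imports "HOL-Analysis.Analysis"
begin

section \<open>Smooth functions and partial derivatives\<close>

primrec C_times :: "nat \<Rightarrow> 'a::real_normed_vector set \<Rightarrow> ('a \<Rightarrow> 'b::real_normed_vector) \<Rightarrow> bool" where
  "C_times 0 S f \<longleftrightarrow> continuous_on S f"
| "C_times (Suc n) S f \<longleftrightarrow> (\<forall>x\<in>S. f differentiable (at x)) \<and>
     (\<forall>v. C_times n S (\<lambda>x. frechet_derivative f (at x) v))"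

text \<open>Only used for open sets \<open>S\<close>; derivatives are unrestricted derivatives at the points
  of \<open>S\<close>, so that the values of \<open>f\<close> outside \<open>S\<close> are irrelevant.\<close>

definition smooth_on :: "'a::real_normed_vector set \<Rightarrow> ('a \<Rightarrow> 'b::real_normed_vector) \<Rightarrow> bool" where
  "smooth_on S f \<longleftrightarrow> (\<forall>n. C_times n S f)"

definition pd :: "2 \<Rightarrow> (real^2 \<Rightarrow> real) \<Rightarrow> real^2 \<Rightarrow> real" where
  "pd i f u = frechet_derivative f (at u) (axis i 1)"

section \<open>Smooth surfaces\<close>

text \<open>A chart is a pair of its domain and its coordinate map; the coordinate map is arbitrary
  outside the domain.\<close>

type_synonym 'a chart = "'a set \<times> ('a \<Rightarrow> real^2)"

definition transition :: "'a chart \<Rightarrow> 'a chart \<Rightarrow> real^2 \<Rightarrow> real^2" where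
  "transition c e = snd e \<circ> inv_into (fst c) (snd c)"

definition coord :: "'a chart \<Rightarrow> ('a \<Rightarrow> real) \<Rightarrow> real^2 \<Rightarrow> real" where
  "coord c f = f \<circ> inv_into (fst c) (snd c)"

definition is_chart :: "'a topology \<Rightarrow> 'a chart \<Rightarrow> bool" where
  "is_chart T c \<longleftrightarrow> openin T (fst c) \<and> open (snd c ` fst c) \<and>
     homeomorphic_map (subtopology T (fst c)) (top_of_set (snd c ` fst c)) (snd c)"

definition compatible :: "'a chart \<Rightarrow> 'a chart \<Rightarrow> bool" where
  "compatible c e \<longleftrightarrow> smooth_on (snd c ` (fst c \<inter> fst e)) (transition c e) \<and>
     smooth_on (snd e ` (fst c \<inter> fst e)) (transition e c)"

record 'a surface =
  topo :: "'a topology"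
  charts :: "'a chart set"

text \<open>The atlas is maximal.\<close>

definition smooth_surface :: "'a surface \<Rightarrow> bool" where
  "smooth_surface M \<longleftrightarrow>
     Hausdorff_space (topo M) \<and> second_countable (topo M) \<and>
     (\<Union>c\<in>charts M. fst c) = topspace (topo M) \<and>
     (\<forall>c\<in>charts M. is_chart (topo M) c) \<and>
     (\<forall>c\<in>charts M. \<forall>e\<in>charts M. compatible c e) \<and>
     (\<forall>c. is_chart (topo M) c \<and> (\<forall>e\<in>charts M. compatible c e) \<longrightarrow> c \<in> charts M)"

definition restrict_surface :: "'a surface \<Rightarrow> 'a set \<Rightarrow> 'a surface" where
  "restrict_surface M V = \<lparr>topo = subtopology (topo M) V, charts = {c\<in>charts M. fst c \<subseteq> V}\<rparr>"

section \<open>Tensors and connections, given by their components in all charts\<close>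

type_synonym 'a covector_field = "'a chart \<Rightarrow> 2 \<Rightarrow> real^2 \<Rightarrow> real"
type_synonym 'a metric_field = "'a chart \<Rightarrow> 2 \<Rightarrow> 2 \<Rightarrow> real^2 \<Rightarrow> real"

text \<open>Christoffel symbols: \<open>D c k i j\<close> is \<open>\<Gamma>\<^sup>k\<^sub>i\<^sub>j\<close> in the chart \<open>c\<close>.\<close>

type_synonym 'a conn = "'a chart \<Rightarrow> 2 \<Rightarrow> 2 \<Rightarrow> 2 \<Rightarrow> real^2 \<Rightarrow> real"

definition one_form :: "'a surface \<Rightarrow> 'a covector_field \<Rightarrow> bool" where
  "one_form M \<rho> \<longleftrightarrow>
     (\<forall>c\<in>charts M. \<forall>i. smooth_on (snd c ` fst c) (\<rho> c i)) \<and>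
     (\<forall>c\<in>charts M. \<forall>e\<in>charts M. \<forall>u\<in>snd c ` (fst c \<inter> fst e). \<forall>i.
        \<rho> c i u = (\<Sum>a\<in>UNIV. pd i (\<lambda>v. transition c e v $ a) u * \<rho> e a (transition c e u)))"

definition riemannian_metric :: "'a surface \<Rightarrow> 'a metric_field \<Rightarrow> bool" where
  "riemannian_metric M g \<longleftrightarrow>
     (\<forall>c\<in>charts M. \<forall>i j. smooth_on (snd c ` fst c) (g c i j)) \<and>
     (\<forall>c\<in>charts M. \<forall>u\<in>snd c ` fst c. (\<forall>i j. g c i j u = g c j i u) \<and>
        (\<forall>w::real^2. w \<noteq> 0 \<longrightarrow> (\<Sum>i\<in>UNIV. \<Sum>j\<in>UNIV. g c i j u * w $ i * w $ j) > 0)) \<and>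
     (\<forall>c\<in>charts M. \<forall>e\<in>charts M. \<forall>u\<in>snd c ` (fst c \<inter> fst e). \<forall>i j.
        g c i j u = (\<Sum>a\<in>UNIV. \<Sum>b\<in>UNIV.
          pd i (\<lambda>v. transition c e v $ a) u * pd j (\<lambda>v. transition c e v $ b) u *
          g e a b (transition c e u)))"

text \<open>Torsion-free affine connections. The last clause is the transformation law of
  Christoffel symbols, with the inverse Jacobian moved to the other side.\<close>

definition connection :: "'a surface \<Rightarrow> 'a conn \<Rightarrow> bool" where
  "connection M D \<longleftrightarrow>
     (\<forall>c\<in>charts M. \<forall>k i j. smooth_on (snd c ` fst c) (D c k i j)) \<and>
     (\<forall>c\<in>charts M. \<forall>u\<in>snd c ` fst c. \<forall>k i j. D c k i j u = D c k j i u) \<and>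
     (\<forall>c\<in>charts M. \<forall>e\<in>charts M. \<forall>u\<in>snd c ` (fst c \<inter> fst e). \<forall>l i j.
        (\<Sum>k\<in>UNIV. D c k i j u * pd k (\<lambda>v. transition c e v $ l) u) =
        pd i (pd j (\<lambda>v. transition c e v $ l)) u +
        (\<Sum>a\<in>UNIV. \<Sum>b\<in>UNIV. D e l a b (transition c e u) *
          pd i (\<lambda>v. transition c e v $ a) u * pd j (\<lambda>v. transition c e v $ b) u))"

text \<open>The Levi-Civita connection of \<open>g\<close>: torsion-free (part of \<open>connection\<close>) and
  \<open>\<nabla>g = 0\<close>.\<close>

definition levi_civita :: "'a surface \<Rightarrow> 'a metric_field \<Rightarrow> 'a conn \<Rightarrow> bool" where
  "levi_civita M g D \<longleftrightarrow> connection M D \<and>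
     (\<forall>c\<in>charts M. \<forall>u\<in>snd c ` fst c. \<forall>k i j.
        pd k (g c i j) u = (\<Sum>l\<in>UNIV. D c l k i u * g c l j u + D c l k j u * g c i l u))"

text \<open>\<open>riemann D c l k i j\<close> is the \<open>l\<close>-th component of
  \<open>R(\<partial>\<^sub>i,\<partial>\<^sub>j)\<partial>\<^sub>k = \<nabla>\<^sub>i\<nabla>\<^sub>j\<partial>\<^sub>k - \<nabla>\<^sub>j\<nabla>\<^sub>i\<partial>\<^sub>k\<close>.\<close>

definition riemann :: "'a conn \<Rightarrow> 'a chart \<Rightarrow> 2 \<Rightarrow> 2 \<Rightarrow> 2 \<Rightarrow> 2 \<Rightarrow> real^2 \<Rightarrow> real" where
  "riemann D c l k i j u = pd i (D c l j k) u - pd j (D c l i k) u +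
     (\<Sum>m\<in>UNIV. D c l i m u * D c m j k u - D c l j m u * D c m i k u)"

definition gauss_curvature :: "'a metric_field \<Rightarrow> 'a conn \<Rightarrow> 'a chart \<Rightarrow> real^2 \<Rightarrow> real" where
  "gauss_curvature g D c u = (\<Sum>l\<in>UNIV. riemann D c l 2 1 2 u * g c l 1 u) /
     (g c 1 1 u * g c 2 2 u - g c 1 2 u * g c 2 1 u)"

definition constant_curvature :: "'a surface \<Rightarrow> 'a metric_field \<Rightarrow> 'a conn \<Rightarrow> bool" where
  "constant_curvature M g D \<longleftrightarrow>
     (\<exists>\<kappa>. \<forall>c\<in>charts M. \<forall>u\<in>snd c ` fst c. gauss_curvature g D c u = \<kappa>)"

section \<open>Projective structures\<close>

definition covariant_derivative ::
  "'a conn \<Rightarrow> 'a chart \<Rightarrow> (real^2 \<Rightarrow> real^2) \<Rightarrow> (real^2 \<Rightarrow> real^2) \<Rightarrow> real^2 \<Rightarrow> real^2" where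
  "covariant_derivative D c X Y u = (\<chi> k. (\<Sum>i\<in>UNIV. X u $ i * pd i (\<lambda>v. Y v $ k) u) +
     (\<Sum>i\<in>UNIV. \<Sum>j\<in>UNIV. D c k i j u * X u $ i * Y u $ j))"

definition covector_apply :: "'a covector_field \<Rightarrow> 'a chart \<Rightarrow> (real^2 \<Rightarrow> real^2) \<Rightarrow> real^2 \<Rightarrow> real" where
  "covector_apply \<rho> c X u = (\<Sum>i\<in>UNIV. \<rho> c i u * X u $ i)"

text \<open>The one-form is global, while \<open>X\<close>, \<open>Y\<close> range over the vector fields on chart domains;
  as both sides of the equation are tensorial, this is the same as ranging over global vector
  fields.\<close>

definition proj_equivalent :: "'a surface \<Rightarrow> 'a conn \<Rightarrow> 'a conn \<Rightarrow> bool" where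
  "proj_equivalent M D D' \<longleftrightarrow> (\<exists>\<rho>. one_form M \<rho> \<and>
     (\<forall>c\<in>charts M. \<forall>X Y. smooth_on (snd c ` fst c) X \<and> smooth_on (snd c ` fst c) Y \<longrightarrow>
        (\<forall>u\<in>snd c ` fst c.
           covariant_derivative D c X Y u - covariant_derivative D' c X Y u =
           covector_apply \<rho> c X u *\<^sub>R Y u + covector_apply \<rho> c Y u *\<^sub>R X u)))"

definition proj_class :: "'a surface \<Rightarrow> 'a conn \<Rightarrow> 'a conn set" where
  "proj_class M D = {D'. connection M D' \<and> proj_equivalent M D D'}"

definition projective_structure :: "'a surface \<Rightarrow> 'a conn set \<Rightarrow> bool" where
  "projective_structure M P \<longleftrightarrow> (\<exists>D. connection M D \<and> P = proj_class M D)"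

section \<open>Foliations and webs\<close>

text \<open>A foliation by curves is given by a covering family of pairs of an open set and a local
  submersion on it, any two of which have locally the same level sets; the leaves are pieced
  together from the local level sets.\<close>

type_synonym 'a fol = "('a set \<times> ('a \<Rightarrow> real)) set"

definition submersion :: "'a surface \<Rightarrow> 'a set \<Rightarrow> ('a \<Rightarrow> real) \<Rightarrow> bool" where
  "submersion M U f \<longleftrightarrow> openin (topo M) U \<and>
     (\<forall>c\<in>charts M. smooth_on (snd c ` (fst c \<inter> U)) (coord c f) \<and>
        (\<forall>u\<in>snd c ` (fst c \<inter> U). \<exists>i. pd i (coord c f) u \<noteq> 0))"

definition same_level_sets_near ::
  "'a surface \<Rightarrow> 'a set \<Rightarrow> 'a \<Rightarrow> ('a \<Rightarrow> real) \<Rightarrow> ('a \<Rightarrow> real) \<Rightarrow> bool" where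
  "same_level_sets_near M S p f h \<longleftrightarrow>
     (\<exists>B. openin (topo M) B \<and> p \<in> B \<and> B \<subseteq> S \<and> (\<forall>q\<in>B. \<forall>r\<in>B. f q = f r \<longleftrightarrow> h q = h r))"

definition foliation :: "'a surface \<Rightarrow> 'a fol \<Rightarrow> bool" where
  "foliation M F \<longleftrightarrow>
     (\<forall>(U, f)\<in>F. submersion M U f) \<and>
     (\<Union>(U, f)\<in>F. U) = topspace (topo M) \<and>
     (\<forall>(U, f)\<in>F. \<forall>(V, h)\<in>F. \<forall>p\<in>U \<inter> V. same_level_sets_near M (U \<inter> V) p f h)"

text \<open>General position: the leaves of distinct foliations are transversal.\<close>

definition web :: "'a surface \<Rightarrow> nat \<Rightarrow> (nat \<Rightarrow> 'a fol) \<Rightarrow> bool" where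
  "web M d W \<longleftrightarrow> (\<forall>i\<in>{1..d}. foliation M (W i)) \<and>
     (\<forall>i\<in>{1..d}. \<forall>j\<in>{1..d}. i \<noteq> j \<longrightarrow>
        (\<forall>(U, f)\<in>W i. \<forall>(V, h)\<in>W j. \<forall>c\<in>charts M. \<forall>u\<in>snd c ` (fst c \<inter> U \<inter> V).
           pd 1 (coord c f) u * pd 2 (coord c h) u - pd 2 (coord c f) u * pd 1 (coord c h) u \<noteq> 0))"

text \<open>A (non-constant, affinely parametrized) geodesic on the open interval \<open>I\<close>.\<close>

definition geodesic :: "'a surface \<Rightarrow> 'a conn \<Rightarrow> real set \<Rightarrow> (real \<Rightarrow> 'a) \<Rightarrow> bool" where
  "geodesic M D I \<gamma> \<longleftrightarrow> continuous_map (top_of_set I) (topo M) \<gamma> \<and>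
     (\<forall>c\<in>charts M. let x = snd c \<circ> \<gamma>; J = {t\<in>I. \<gamma> t \<in> fst c};
          x' = (\<lambda>t. vector_derivative x (at t)); x'' = (\<lambda>t. vector_derivative x' (at t)) in
        smooth_on J x \<and>
        (\<forall>t\<in>J. x' t \<noteq> 0 \<and>
          (\<forall>k. x'' t $ k + (\<Sum>i\<in>UNIV. \<Sum>j\<in>UNIV. D c k i j (x t) * x' t $ i * x' t $ j) = 0)))"

text \<open>All leaves are geodesics: near each of its points, the leaf is traced out by a geodesic.\<close>

definition leaves_geodesic :: "'a surface \<Rightarrow> 'a conn \<Rightarrow> nat \<Rightarrow> (nat \<Rightarrow> 'a fol) \<Rightarrow> bool" where
  "leaves_geodesic M D d W \<longleftrightarrow> (\<forall>i\<in>{1..d}. \<forall>(U, f)\<in>W i. \<forall>p\<in>U.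
     \<exists>\<epsilon>>0. \<exists>\<gamma>. geodesic M D {-\<epsilon><..<\<epsilon>} \<gamma> \<and> \<gamma> 0 = p \<and>
       (\<forall>t\<in>{-\<epsilon><..<\<epsilon>}. \<gamma> t \<in> U \<and> f (\<gamma> t) = f p))"

definition geodesic_web :: "'a surface \<Rightarrow> nat \<Rightarrow> (nat \<Rightarrow> 'a fol) \<Rightarrow> bool" where
  "geodesic_web M d W \<longleftrightarrow> web M d W \<and> (\<exists>D. connection M D \<and> leaves_geodesic M D d W)"

text \<open>The projective structure determined by a geodesic web. Projectively equivalent connections
  have the same unparametrized geodesics, so it does not matter which member of the class is
  used to say that the leaves are geodesics of the structure. For \<open>d \<ge> 4\<close> the structure is
  unique.\<close>

definition web_projective_structure :: "'a surface \<Rightarrow> nat \<Rightarrow> (nat \<Rightarrow> 'a fol) \<Rightarrow> 'a conn set" where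
  "web_projective_structure M d W =
     (THE P. projective_structure M P \<and> (\<exists>D\<in>P. leaves_geodesic M D d W))"

section \<open>The second-order invariants\<close>

definition Flex :: "(real^2 \<Rightarrow> real) \<Rightarrow> real^2 \<Rightarrow> real" where
  "Flex f u = (pd 2 f u)\<^sup>2 * pd 1 (pd 1 f) u - 2 * pd 1 f u * pd 2 f u * pd 2 (pd 1 f) u +
     (pd 1 f u)\<^sup>2 * pd 2 (pd 2 f) u"

text \<open>The quadruple stands for
  \<open>(\<Pi>\<^sup>1\<^sub>2\<^sub>2, \<Pi>\<^sup>1\<^sub>1\<^sub>2, \<Pi>\<^sup>2\<^sub>1\<^sub>2, \<Pi>\<^sup>2\<^sub>1\<^sub>1)\<close>.\<close>

fun flex_defect :: "real \<times> real \<times> real \<times> real \<Rightarrow> (real^2 \<Rightarrow> real) \<Rightarrow> real^2 \<Rightarrow> real" where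
  "flex_defect (P122, P112, P212, P211) f u =
     P122 * (pd 1 f u)^3 - 3 * P112 * (pd 1 f u)\<^sup>2 * pd 2 f u
     - 3 * P212 * pd 1 f u * (pd 2 f u)\<^sup>2 + P211 * (pd 2 f u)^3 - Flex f u"

definition subweb_Pi :: "(nat \<Rightarrow> real^2 \<Rightarrow> real) \<Rightarrow> real^2 \<Rightarrow> real \<times> real \<times> real \<times> real" where
  "subweb_Pi f u = (THE P. \<forall>i\<in>{1..4}. flex_defect P (f i) u = 0)"

definition web_invariant :: "(nat \<Rightarrow> real^2 \<Rightarrow> real) \<Rightarrow> nat \<Rightarrow> real^2 \<Rightarrow> real" where
  "web_invariant f j u = flex_defect (subweb_Pi f u) (f j) u"

definition web_invariants_vanish :: "'a surface \<Rightarrow> nat \<Rightarrow> (nat \<Rightarrow> 'a fol) \<Rightarrow> bool" where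
  "web_invariants_vanish M d W \<longleftrightarrow> (\<forall>c\<in>charts M. \<forall>U f p.
     p \<in> fst c \<and> (\<forall>i\<in>{1..d}. (U i, f i) \<in> W i \<and> p \<in> U i) \<longrightarrow>
     (\<forall>j\<in>{5..d}. web_invariant (\<lambda>i. coord c (f i)) j (snd c p) = 0))"

section \<open>Mappings\<close>

text \<open>\<open>\<phi>\<close> maps the open set \<open>V\<close> of \<open>M\<close> diffeomorphically onto the open set \<open>\<phi> ` V\<close> of \<open>M'\<close>.\<close>

definition diffeo_on :: "'a surface \<Rightarrow> 'a set \<Rightarrow> ('a \<Rightarrow> 'b) \<Rightarrow> 'b surface \<Rightarrow> bool" where
  "diffeo_on M V \<phi> M' \<longleftrightarrow> openin (topo M) V \<and> openin (topo M') (\<phi> ` V) \<and>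
     homeomorphic_map (subtopology (topo M) V) (subtopology (topo M') (\<phi> ` V)) \<phi> \<and>
     (\<forall>c\<in>charts M. \<forall>e\<in>charts M'.
        smooth_on (snd c ` {p\<in>fst c \<inter> V. \<phi> p \<in> fst e})
          (snd e \<circ> \<phi> \<circ> inv_into (fst c) (snd c)) \<and>
        smooth_on (snd e ` {q\<in>fst e \<inter> \<phi> ` V. inv_into V \<phi> q \<in> fst c})
          (snd c \<circ> inv_into V \<phi> \<circ> inv_into (fst e) (snd e)))"

definition local_diffeo :: "'a surface \<Rightarrow> 'a set \<Rightarrow> ('a \<Rightarrow> 'b) \<Rightarrow> 'b surface \<Rightarrow> bool" where
  "local_diffeo M N \<phi> M' \<longleftrightarrow> openin (topo M) N \<and> (\<forall>p\<in>N. \<exists>V\<subseteq>N. p \<in> V \<and> diffeo_on M V \<phi> M')"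

text \<open>The foliations of \<open>W\<close> are carried to those of \<open>W'\<close>, possibly in a different order.\<close>

definition web_mapping :: "'a surface \<Rightarrow> (nat \<Rightarrow> 'a fol) \<Rightarrow> 'a set \<Rightarrow> ('a \<Rightarrow> 'b) \<Rightarrow>
    'b surface \<Rightarrow> (nat \<Rightarrow> 'b fol) \<Rightarrow> nat \<Rightarrow> bool" where
  "web_mapping M W N \<phi> M' W' d \<longleftrightarrow> local_diffeo M N \<phi> M' \<and>
     (\<exists>\<sigma>. bij_betw \<sigma> {1..d} {1..d} \<and>
        (\<forall>i\<in>{1..d}. \<forall>(U, f)\<in>W i. \<forall>(U', h)\<in>W' (\<sigma> i). \<forall>p\<in>N \<inter> U. \<phi> p \<in> U' \<longrightarrow>
           same_level_sets_near M {q\<in>N \<inter> U. \<phi> q \<in> U'} p f (h \<circ> \<phi>)))"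

text \<open>The pullback of a connection by a diffeomorphism on \<open>V\<close>: transport a chart of \<open>V\<close> by \<open>\<phi>\<close>
  to a chart of the target, and take the components there. This uses maximality of the atlas.\<close>

definition pullback :: "'a set \<Rightarrow> ('a \<Rightarrow> 'b) \<Rightarrow> 'b conn \<Rightarrow> 'a conn" where
  "pullback V \<phi> D = (\<lambda>c. D (\<phi> ` fst c, snd c \<circ> inv_into V \<phi>))"

definition carries_projective_structure :: "'a surface \<Rightarrow> 'a conn set \<Rightarrow> 'a set \<Rightarrow> ('a \<Rightarrow> 'b) \<Rightarrow>
    'b surface \<Rightarrow> 'b conn set \<Rightarrow> bool" where
  "carries_projective_structure M P N \<phi> M' P' \<longleftrightarrow>
     (\<forall>V\<subseteq>N. diffeo_on M V \<phi> M' \<longrightarrow>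
        (\<forall>D\<in>P. \<forall>D'\<in>P'. pullback V \<phi> D' \<in> proj_class (restrict_surface M V) D))"

definition projective_transformation :: "'a surface \<Rightarrow> (nat \<Rightarrow> 'a fol) \<Rightarrow> 'a set \<Rightarrow> ('a \<Rightarrow> 'b) \<Rightarrow>
    'b surface \<Rightarrow> (nat \<Rightarrow> 'b fol) \<Rightarrow> nat \<Rightarrow> bool" where
  "projective_transformation M W N \<phi> M' W' d \<longleftrightarrow>
     carries_projective_structure M (web_projective_structure M d W) N \<phi> M'
       (web_projective_structure M' d W')"

end

(* Differentiating twice along a geodesic inside a level set of F shows that the quadratic form of
   the Hessian of F minus dF composed with the Christoffel symbols vanishes on the kernel of dF.
   A web mapping sends each leaf, which is a geodesic on the source, into a level set of a web function
   of the target, so in a common chart the connection of the source and the pulled back connection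
   of the target satisfy this condition for the same functions. Their difference is then a binary
   cubic in the conormals with at least four distinct zeros, hence it vanishes up to its trace
   part, which means that the two connections are projectively equivalent. *)

theory Submission
  imports Defs
begin

section \<open>Smooth functions and partial derivatives\<close>

text \<open>The cubic is special to dimension two. Let \<open>w\<close> = (-F_2, F_1) and let T be
  the difference tensor; then dF(T(w,w)) is a cubic form in the components of dF. A trace part,
  sending (X,Y) to rho(X)Y + rho(Y)X, contributes 2 rho(w) dF(w) = 0, so the four coefficients
  record exactly the other four of the six components of T. A nonzero binary cubic has at most three
  zeros up to scaling, which is where four foliations enter. Three obstacles shape the rest. The
  pulled back connection is read off in the target chart with the same coordinates; this avoids the
  chain rule for the mapping, but transported charts must be shown to lie in the target atlas. The
  covectors found pointwise must fit together to a smooth one-form: they are explicit traces, hence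
  smooth, and their transformation law comes from subtracting those of the two connections. Finally,
  the projective structure of a web is a definite description, so its uniqueness has to be
  established before it can be computed.\<close>

lemma has_derivative_cong_open:
  assumes "open S" "x \<in> S" "\<And>y. y \<in> S \<Longrightarrow> f y = g y"
  shows "(f has_derivative f') (at x) \<longleftrightarrow> (g has_derivative f') (at x)"
  using assms has_derivative_transform_within_open[of f f' x UNIV S g]
    has_derivative_transform_within_open[of g f' x UNIV S f]
  by metis

lemma differentiable_cong_open:
  assumes "open S" "x \<in> S" "\<And>y. y \<in> S \<Longrightarrow> f y = g y"
  shows "f differentiable (at x) \<longleftrightarrow> g differentiable (at x)"
  unfolding differentiable_def using has_derivative_cong_open[OF assms] by simp

text \<open>\<open>frechet_derivative\<close> is a choice among all derivatives. Both sides choose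
  from the same predicate, so they agree even where no derivative exists.\<close>

lemma frechet_derivative_cong_open:
  assumes "open S" "x \<in> S" "\<And>y. y \<in> S \<Longrightarrow> f y = g y"
  shows "frechet_derivative f (at x) = frechet_derivative g (at x)"
  unfolding frechet_derivative_def using has_derivative_cong_open[OF assms] by simp

lemma pd_cong_open:
  assumes "open S" "x \<in> S" "\<And>y. y \<in> S \<Longrightarrow> f y = g y"
  shows "pd i f x = pd i g x"
  unfolding pd_def using frechet_derivative_cong_open[OF assms] by simp

lemma C_times_cong:
  assumes "open S" "\<And>x. x \<in> S \<Longrightarrow> f x = g x"
  shows "C_times n S f \<longleftrightarrow> C_times n S g"
  using assms(2)
proof (induction n arbitrary: f g)
  case 0
  then show ?case by (simp cong: continuous_on_cong)
next
  case (Suc n)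
  have "C_times n S (\<lambda>x. frechet_derivative f (at x) v)
      \<longleftrightarrow> C_times n S (\<lambda>x. frechet_derivative g (at x) v)" for v
    by (rule Suc.IH) (use frechet_derivative_cong_open[OF assms(1) _ Suc.prems] in simp)
  then show ?case
    using differentiable_cong_open[OF assms(1) _ Suc.prems] by auto
qed

lemma smooth_on_cong:
  assumes "open S" "\<And>x. x \<in> S \<Longrightarrow> f x = g x"
  shows "smooth_on S f \<longleftrightarrow> smooth_on S g"
  unfolding smooth_on_def using C_times_cong[OF assms] by simp

lemma smooth_on_differentiable:
  assumes "smooth_on S f" "x \<in> S"
  shows "f differentiable (at x)"
proof -
  have "C_times (Suc 0) S f" using assms(1) unfolding smooth_on_def by blast
  with assms(2) show ?thesis by simp
qed

lemma smooth_on_frechet_derivative: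
  assumes "smooth_on S f"
  shows "smooth_on S (\<lambda>x. frechet_derivative f (at x) v)"
  unfolding smooth_on_def
proof
  fix n
  have "C_times (Suc n) S f" using assms unfolding smooth_on_def by blast
  then show "C_times n S (\<lambda>x. frechet_derivative f (at x) v)" by simp
qed

lemma smooth_on_pd: "smooth_on S f \<Longrightarrow> smooth_on S (pd i f)"
  using smooth_on_frechet_derivative[of S f "axis i 1"] by (simp add: pd_def[abs_def])

lemma smooth_on_const:
  fixes S :: "'a::real_normed_vector set" and k :: "'b::real_normed_vector"
  shows "smooth_on S (\<lambda>x. k)"
proof -
  have "C_times n S (\<lambda>x. k)" for n and k :: 'b
    by (induction n arbitrary: k) simp_all
  then show ?thesis by (simp add: smooth_on_def)
qed

lemma frechet_derivative_add_fun:
  assumes "f differentiable (at x)" "g differentiable (at x)"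
  shows "frechet_derivative (\<lambda>x. f x + g x) (at x) v
    = frechet_derivative f (at x) v + frechet_derivative g (at x) v"
  using frechet_derivative_at[OF has_derivative_add[OF assms[unfolded frechet_derivative_works]]]
  by metis

lemma frechet_derivative_scaleR_fun:
  assumes "f differentiable (at x)"
  shows "frechet_derivative (\<lambda>x. k *\<^sub>R f x) (at x) v = k *\<^sub>R frechet_derivative f (at x) v"
  using frechet_derivative_at[OF has_derivative_scaleR_right[OF assms[unfolded frechet_derivative_works]]]
  by metis

lemma smooth_on_add:
  fixes f g :: "'a::real_normed_vector \<Rightarrow> 'b::real_normed_vector"
  assumes "open S" "smooth_on S f" "smooth_on S g"
  shows "smooth_on S (\<lambda>x. f x + g x)"
proof -
  \<comment> \<open>The functions are generalised because the induction step applies the hypothesis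
    to their directional derivatives.\<close>
  have "C_times n S (\<lambda>x. f x + g x)" if "C_times n S f" "C_times n S g" for n and f g :: "'a \<Rightarrow> 'b"
    using that
  proof (induction n arbitrary: f g)
    case 0
    then show ?case by (simp add: continuous_on_add)
  next
    case (Suc n)
    have "C_times n S (\<lambda>x. frechet_derivative (\<lambda>x. f x + g x) (at x) v)" for v
    proof -
      have "C_times n S (\<lambda>x. frechet_derivative f (at x) v + frechet_derivative g (at x) v)"
        using Suc by simp
      then show ?thesis
        by (rule C_times_cong[OF assms(1), THEN iffD1, rotated])
          (use Suc.prems in \<open>simp add: frechet_derivative_add_fun\<close>)
    qed
    then show ?case using Suc.prems by simp
  qed
  with assms(2,3) show ?thesis by (simp add: smooth_on_def)
qed

lemma smooth_on_scaleR:
  fixes f :: "'a::real_normed_vector \<Rightarrow> 'b::real_normed_vector"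
  assumes "open S" "smooth_on S f"
  shows "smooth_on S (\<lambda>x. k *\<^sub>R f x)"
proof -
  have "C_times n S (\<lambda>x. k *\<^sub>R f x)" if "C_times n S f" for n and f :: "'a \<Rightarrow> 'b"
    using that
  proof (induction n arbitrary: f)
    case 0
    then show ?case by (simp add: continuous_on_scaleR)
  next
    case (Suc n)
    have "C_times n S (\<lambda>x. frechet_derivative (\<lambda>x. k *\<^sub>R f x) (at x) v)" for v
    proof -
      have "C_times n S (\<lambda>x. k *\<^sub>R frechet_derivative f (at x) v)"
        using Suc by simp
      then show ?thesis
        by (rule C_times_cong[OF assms(1), THEN iffD1, rotated])
          (use Suc.prems in \<open>simp add: frechet_derivative_scaleR_fun\<close>)
    qed
    then show ?case using Suc.prems by simp
  qed
  with assms(2) show ?thesis by (simp add: smooth_on_def)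
qed

lemma frechet_derivative_eq_sum_pd:
  assumes "f differentiable (at u)"
  shows "frechet_derivative f (at u) v = (\<Sum>i\<in>UNIV. pd i f u * v $ i)"
proof -
  interpret linear "frechet_derivative f (at u)"
    using assms by (rule linear_frechet_derivative)
  have "v = (\<Sum>i\<in>UNIV. v $ i *\<^sub>R axis i 1)"
    using basis_expansion[of v] by (simp add: scalar_mult_eq_scaleR)
  then have "frechet_derivative f (at u) v = (\<Sum>i\<in>UNIV. v $ i *\<^sub>R frechet_derivative f (at u) (axis i 1))"
    by (metis (no_types, lifting) sum scaleR sum.cong)
  then show ?thesis by (simp add: pd_def mult.commute)
qed

text \<open>The chain rule in partial derivatives. It is applied along a leaf first to a web
  function and then to its partial derivatives.\<close>

lemma has_real_derivative_along_curve:
  assumes "f differentiable (at (x t))" "(x has_vector_derivative v) (at t)"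
  shows "((\<lambda>t. f (x t)) has_real_derivative (\<Sum>i\<in>UNIV. pd i f (x t) * v $ i)) (at t)"
proof -
  have "(f \<circ> x has_derivative frechet_derivative f (at (x t)) \<circ> (\<lambda>s. s *\<^sub>R v)) (at t)"
    using assms by (intro diff_chain_at)
      (auto simp: has_vector_derivative_def frechet_derivative_works[symmetric])
  moreover have "frechet_derivative f (at (x t)) \<circ> (\<lambda>s. s *\<^sub>R v)
      = (*) (\<Sum>i\<in>UNIV. pd i f (x t) * v $ i)"
    using assms(1) by (auto simp: fun_eq_iff frechet_derivative_eq_sum_pd sum_distrib_left mult_ac)
  ultimately show ?thesis by (simp add: has_field_derivative_def comp_def)
qed

section \<open>Charts\<close>

lemma is_chartD:
  assumes "is_chart T c"
  shows "openin T (fst c)" "inj_on (snd c) (fst c)"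
proof -
  show o: "openin T (fst c)" using assms by (simp add: is_chart_def)
  then have "topspace (subtopology T (fst c)) = fst c"
    by (meson openin_subset topspace_subtopology_subset)
  then show "inj_on (snd c) (fst c)"
    using assms homeomorphic_imp_injective_map unfolding is_chart_def by metis
qed

lemma is_chart_open_image:
  assumes "is_chart T c" "openin T A" "A \<subseteq> fst c"
  shows "open (snd c ` A)"
proof -
  have "openin (subtopology T (fst c)) A"
    using assms by (meson openin_subset_topspace_eq openin_subtopology_alt subset_openin_subtopology)
  then have "openin (top_of_set (snd c ` fst c)) (snd c ` A)"
    using assms(1) homeomorphic_imp_open_map unfolding is_chart_def open_map_def by metis
  then show ?thesis
    using assms(1) openin_open_trans unfolding is_chart_def by blast
qed

lemma transition_apply:
  assumes "is_chart T c" "p \<in> fst c"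
  shows "transition c e (snd c p) = snd e p"
  using assms is_chartD(2)[OF assms(1)] by (simp add: transition_def)

lemma coord_apply:
  assumes "is_chart T c" "p \<in> fst c"
  shows "coord c f (snd c p) = f p"
  using assms is_chartD(2)[OF assms(1)] by (simp add: coord_def)

text \<open>If all entries vanished, the chain rule would give the identity, which is a composition
  of two transition maps, the derivative zero. One nonzero entry is enough to compare covectors in
  two charts.\<close>

lemma transition_jacobian_nonzero:
  assumes "is_chart T c" "is_chart T e" "compatible c e" "u \<in> snd c ` (fst c \<inter> fst e)"
  shows "\<exists>i a. pd i (\<lambda>v. transition c e v $ a) u \<noteq> 0"
proof (rule ccontr)
  assume "\<not> ?thesis"
  then have zero: "pd i (\<lambda>v. transition c e v $ a) u = 0" for i a by blast
  let ?S = "snd c ` (fst c \<inter> fst e)"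
  let ?A = "frechet_derivative (transition c e) (at u)"
  let ?B = "frechet_derivative (transition e c) (at (transition c e u))"
  have S: "open ?S"
    using assms(1,2) by (intro is_chart_open_image[of T] openin_Int is_chartD(1)) auto
  have compat: "smooth_on ?S (transition c e)" "smooth_on (snd e ` (fst c \<inter> fst e)) (transition e c)"
    using assms(3) by (simp_all add: compatible_def)
  have A: "(transition c e has_derivative ?A) (at u)"
    using smooth_on_differentiable[OF compat(1) assms(4)] by (rule frechet_derivative_works[THEN iffD1])
  have "transition c e u \<in> snd e ` (fst c \<inter> fst e)"
    using assms(4) by (elim imageE) (simp add: transition_apply[OF assms(1)])
  then have B: "(transition e c has_derivative ?B) (at (transition c e u))"
    by (rule frechet_derivative_works[THEN iffD1, OF smooth_on_differentiable[OF compat(2)]])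
  with A have BA: "(transition e c \<circ> transition c e has_derivative ?B \<circ> ?A) (at u)"
    by (rule diff_chain_at)
  have "?A v = 0" for v
  proof (rule vec_eq_iff[THEN iffD2], rule allI)
    fix a
    have comp: "((\<lambda>v. transition c e v $ a) has_derivative (\<lambda>v. ?A v $ a)) (at u)"
      using A by (rule bounded_linear.has_derivative[OF bounded_linear_vec_nth])
    then have "?A v $ a = frechet_derivative (\<lambda>v. transition c e v $ a) (at u) v"
      by (metis frechet_derivative_at)
    also have "\<dots> = 0"
      using comp by (subst frechet_derivative_eq_sum_pd) (auto simp: differentiable_def zero)
    finally show "?A v $ a = 0 $ a" by simp
  qed
  moreover have "?B 0 = 0"
    using linear_0[OF has_derivative_linear[OF B]] .
  ultimately have "(transition e c \<circ> transition c e has_derivative (\<lambda>v. 0)) (at u)"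
    using BA by (simp add: comp_def)
  moreover have "(transition e c \<circ> transition c e) v = v" if "v \<in> ?S" for v
    using that by (elim imageE) (simp add: transition_apply[OF assms(1)] transition_apply[OF assms(2)])
  ultimately have "((\<lambda>v. v) has_derivative (\<lambda>v. 0)) (at u)"
    using has_derivative_cong_open[OF S assms(4), of "transition e c \<circ> transition c e" "\<lambda>v. v"]
    by simp
  then have "(\<lambda>v. v) = (\<lambda>v::real^2. 0::real^2)"
    using has_derivative_ident has_derivative_unique by blast
  then have "axis 1 1 = (0::real^2)" by metis
  then show False by (simp add: axis_eq_0_iff)
qed

section \<open>Geodesics in level sets\<close>

text \<open>The second derivative along a curve in a level set of \<open>F\<close>, evaluated on
  \<open>w = (-F\<^sub>2, F\<^sub>1)\<close>, which spans the kernel of the differential.\<close>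

definition flex_condition :: "(2 \<Rightarrow> 2 \<Rightarrow> 2 \<Rightarrow> real) \<Rightarrow> (real^2 \<Rightarrow> real) \<Rightarrow> real^2 \<Rightarrow> bool" where
  "flex_condition G F u \<longleftrightarrow> (let w = vector [- pd 2 F u, pd 1 F u] :: real^2 in
     (\<Sum>i\<in>UNIV. \<Sum>j\<in>UNIV. pd j (pd i F) u * w $ i * w $ j) =
     (\<Sum>k\<in>UNIV. pd k F u * (\<Sum>i\<in>UNIV. \<Sum>j\<in>UNIV. G k i j * w $ i * w $ j)))"

lemma flex_condition_if_level_geodesic:
  assumes "geodesic M D {-\<epsilon><..<\<epsilon>} \<gamma>" "\<epsilon> > 0" "c \<in> charts M" "is_chart (topo M) c"
    and "\<gamma> 0 \<in> fst c" "openin (topo M) B" "\<gamma> 0 \<in> B" "smooth_on S F"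
    and level: "\<And>t. t \<in> {-\<epsilon><..<\<epsilon>} \<Longrightarrow> \<gamma> t \<in> B \<Longrightarrow> \<gamma> t \<in> fst c \<Longrightarrow>
      snd c (\<gamma> t) \<in> S \<and> F (snd c (\<gamma> t)) = k"
    and u: "u = snd c (\<gamma> 0)"
  shows "flex_condition (\<lambda>k i j. D c k i j u) F u"
proof -
  define x where "x = snd c \<circ> \<gamma>"
  define x' where "x' t = vector_derivative x (at t)" for t
  define x'' where "x'' t = vector_derivative x' (at t)" for t
  define J where "J = {t \<in> {-\<epsilon><..<\<epsilon>}. \<gamma> t \<in> fst c}"
  \<comment> \<open>The level condition is known only inside \<open>B\<close>, so all
    differentiation takes place on this open set of parameters around 0.\<close>
  define K where "K = {t \<in> {-\<epsilon><..<\<epsilon>}. \<gamma> t \<in> B \<inter> fst c}"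
  have "continuous_map (top_of_set {-\<epsilon><..<\<epsilon>}) (topo M) \<gamma>"
    using assms(1) by (simp add: geodesic_def)
  moreover have "openin (topo M) (B \<inter> fst c)"
    using assms(4,6) is_chartD(1) by blast
  ultimately have "openin (top_of_set {-\<epsilon><..<\<epsilon>}) K"
    unfolding K_def using openin_continuous_map_preimage by fastforce
  then have K: "open K" "K \<subseteq> J" "0 \<in> K"
    using assms(2,5,7) by (auto simp: K_def J_def openin_open_eq)
  have "smooth_on J x \<and> (\<forall>t\<in>J. x' t \<noteq> 0 \<and>
      (\<forall>k. x'' t $ k + (\<Sum>i\<in>UNIV. \<Sum>j\<in>UNIV. D c k i j (x t) * x' t $ i * x' t $ j) = 0))"
    using assms(1,3) unfolding geodesic_def Let_def x_def x'_def[abs_def] x''_def[abs_def] J_def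
    by (elim conjE) (drule (1) bspec, assumption)
  then have geo: "smooth_on J x" "\<And>t. t \<in> J \<Longrightarrow> x' t \<noteq> 0" "\<And>t k. t \<in> J \<Longrightarrow>
      x'' t $ k + (\<Sum>i\<in>UNIV. \<Sum>j\<in>UNIV. D c k i j (x t) * x' t $ i * x' t $ j) = 0"
    by auto
  have x1: "(x has_vector_derivative x' t) (at t)" if "t \<in> K" for t
    using that K(2) smooth_on_differentiable[OF geo(1)]
    by (auto simp: x'_def vector_derivative_works[symmetric])
  have x'_eq: "x' t = frechet_derivative x (at t) 1" if "t \<in> K" for t
    using x1[OF that] by (metis frechet_derivative_at has_vector_derivative_def scaleR_one)
  have x2: "(x' has_vector_derivative x'' t) (at t)" if "t \<in> K" for t
  proof -
    have "(\<lambda>t. frechet_derivative x (at t) 1) differentiable (at t)"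
      using smooth_on_differentiable[OF smooth_on_frechet_derivative[OF geo(1)]] that K(2) by blast
    then have "x' differentiable (at t)"
      using differentiable_cong_open[OF K(1) that x'_eq] by simp
    then show ?thesis by (simp add: x''_def vector_derivative_works[symmetric])
  qed
  have xS: "x t \<in> S" "F (x t) = k" if "t \<in> K" for t
    using level that by (auto simp: K_def x_def)
  \<comment> \<open>A function that is constant on the open set \<open>K\<close> has derivative zero
    there. This serves for F along the curve and again for its first derivative.\<close>
  have const: "a = 0" if "(f has_real_derivative a) (at t)" "t \<in> K" "\<And>t. t \<in> K \<Longrightarrow> f t = b"
    for f a b t
  proof -
    have "((\<lambda>_. b) has_real_derivative a) (at t)"
      using that has_derivative_cong_open[OF K(1) that(2), of f "\<lambda>_. b"]
      by (simp add: has_field_derivative_def)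
    then show ?thesis using DERIV_const DERIV_unique by blast
  qed
  have first: "(\<Sum>i\<in>UNIV. pd i F (x t) * x' t $ i) = 0" if "t \<in> K" for t
    using that xS smooth_on_differentiable[OF assms(8)] x1
    by (intro const[of "\<lambda>t. F (x t)" _ t k] has_real_derivative_along_curve) auto
  have x0: "x 0 = u" by (simp add: x_def u)
  have "((\<lambda>t. \<Sum>i\<in>UNIV. pd i F (x t) * x' t $ i) has_real_derivative
      (\<Sum>i\<in>UNIV. (\<Sum>j\<in>UNIV. pd j (pd i F) (x 0) * x' 0 $ j) * x' 0 $ i +
        x'' 0 $ i * pd i F (x 0))) (at 0)"
  proof (intro DERIV_sum DERIV_mult)
    fix i :: 2
    show "((\<lambda>t. pd i F (x t)) has_real_derivative (\<Sum>j\<in>UNIV. pd j (pd i F) (x 0) * x' 0 $ j)) (at 0)"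
      using K(3) xS x1 smooth_on_differentiable[OF smooth_on_pd[OF assms(8)]]
      by (intro has_real_derivative_along_curve) auto
    show "((\<lambda>t. x' t $ i) has_real_derivative x'' 0 $ i) (at 0)"
      using bounded_linear.has_derivative[OF bounded_linear_vec_nth,
          OF x2[OF K(3), unfolded has_vector_derivative_def]]
      by (simp add: has_field_derivative_def mult_commute_abs)
  qed
  then have second: "(\<Sum>i\<in>UNIV. (\<Sum>j\<in>UNIV. pd j (pd i F) u * x' 0 $ j) * x' 0 $ i +
        x'' 0 $ i * pd i F u) = 0"
    unfolding x0 using first by (rule const[OF _ K(3)])
  have acc: "x'' 0 $ k = - (\<Sum>i\<in>UNIV. \<Sum>j\<in>UNIV. D c k i j u * x' 0 $ i * x' 0 $ j)" for k
    using geo(3)[of 0 k] K x0 by auto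
  define a b where "a = pd 1 F u" and "b = pd 2 F u"
  have kernel: "a * x' 0 $ 1 + b * x' 0 $ 2 = 0"
    using first[OF K(3)] by (simp add: sum_2 x0 a_def b_def)
  have nz: "x' 0 $ 1 \<noteq> 0 \<or> x' 0 $ 2 \<noteq> 0"
    using geo(2)[of 0] K by (auto simp: vec_eq_iff forall_2)
  show ?thesis
  proof (cases "a = 0 \<and> b = 0")
    \<comment> \<open>At a critical point of F the vector \<open>w\<close> is zero and both sides of
      the condition vanish.\<close>
    case True
    then show ?thesis by (simp add: flex_condition_def sum_2 a_def b_def)
  next
    case False
    \<comment> \<open>The velocity lies in the kernel of dF, which is spanned by (-b, a). Both sides
      of the condition are quadratic in the velocity, so the nonzero factor \<open>l\<close> cancels
      as its square.\<close>
    obtain l where l: "x' 0 $ 1 = - l * b" "x' 0 $ 2 = l * a"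
    proof (cases "a = 0")
      case True
      with False kernel show ?thesis by (intro that[of "- x' 0 $ 1 / b"]) auto
    next
      case False
      with kernel show ?thesis
        by (intro that[of "x' 0 $ 2 / a"]) (auto simp: field_simps add_eq_0_iff)
    qed
    then have "l \<noteq> 0" using nz by auto
    have "l\<^sup>2 * (\<Sum>i\<in>UNIV. \<Sum>j\<in>UNIV. pd j (pd i F) u * vector [-b, a] $ i * vector [-b, a] $ j) =
      l\<^sup>2 * (\<Sum>k\<in>UNIV. pd k F u * (\<Sum>i\<in>UNIV. \<Sum>j\<in>UNIV. D c k i j u *
         vector [-b, a] $ i * vector [-b, a] $ j))"
      using second unfolding acc
      by (simp add: sum_2 l power2_eq_square algebra_simps)
    with \<open>l \<noteq> 0\<close> show ?thesis
      by (simp add: flex_condition_def a_def b_def)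
  qed
qed

section \<open>Projective equivalence\<close>

text \<open>Four pairwise independent zeros are one more than a nonzero binary cubic form can have
  on the projective line.\<close>

lemma binary_cubic_eq_zero:
  fixes x y :: "nat \<Rightarrow> real"
  assumes zero: "\<And>i. i \<in> {1..4} \<Longrightarrow>
      a * (x i)^3 + b * (x i)\<^sup>2 * y i + c * x i * (y i)\<^sup>2 + e * (y i)^3 = 0"
    and indep: "\<And>i j. i \<in> {1..4} \<Longrightarrow> j \<in> {1..4} \<Longrightarrow> i \<noteq> j \<Longrightarrow> x i * y j - y i * x j \<noteq> 0"
  shows "a = 0 \<and> b = 0 \<and> c = 0 \<and> e = 0"
proof -
  \<comment> \<open>In the basis given by the first two zeros, the cubic is \<open>s t (\<alpha> s + \<beta> t)\<close>.\<close>
  define C where "C X Y = a * X^3 + b * X\<^sup>2 * Y + c * X * Y\<^sup>2 + e * Y^3" for X Y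
  define \<Delta> where "\<Delta> = x 1 * y 2 - y 1 * x 2"
  define s where "s X Y = X * y 2 - Y * x 2" for X Y
  define t where "t X Y = x 1 * Y - y 1 * X" for X Y
  \<comment> \<open>With p and q the first two zeros, \<open>\<alpha>\<close> and
    \<open>\<beta>\<close> are the coefficients of s^2 t and s t^2 in the expansion of C(s p + t q).
    The coefficients of s^3 and t^3 are C(p) = 0 and C(q) = 0.\<close>
  define \<alpha> where "\<alpha> = 3 * a * (x 1)\<^sup>2 * x 2 + b * ((x 1)\<^sup>2 * y 2 + 2 * x 1 * x 2 * y 1)
    + c * ((y 1)\<^sup>2 * x 2 + 2 * y 1 * y 2 * x 1) + 3 * e * (y 1)\<^sup>2 * y 2"
  define \<beta> where "\<beta> = 3 * a * (x 2)\<^sup>2 * x 1 + b * ((x 2)\<^sup>2 * y 1 + 2 * x 1 * x 2 * y 2)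
    + c * ((y 2)\<^sup>2 * x 1 + 2 * y 1 * y 2 * x 2) + 3 * e * (y 2)\<^sup>2 * y 1"
  have C0: "C (x i) (y i) = 0" if "i \<in> {1..4}" for i
    using zero[OF that] by (simp add: C_def)
  have "\<Delta> \<noteq> 0" using indep[of 1 2] by (simp add: \<Delta>_def)
  have coords: "\<Delta> * X = s X Y * x 1 + t X Y * x 2" "\<Delta> * Y = s X Y * y 1 + t X Y * y 2" for X Y
    by (simp_all add: \<Delta>_def s_def t_def algebra_simps)
  have "\<Delta>^3 * C X Y = C (\<Delta> * X) (\<Delta> * Y)" for X Y
    by (simp add: C_def power_mult_distrib algebra_simps power2_eq_square power3_eq_cube)
  also have "C (\<Delta> * X) (\<Delta> * Y) = (s X Y)^3 * C (x 1) (y 1) + (t X Y)^3 * C (x 2) (y 2)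
      + s X Y * t X Y * (s X Y * \<alpha> + t X Y * \<beta>)" for X Y
    unfolding coords[where X = X and Y = Y] C_def \<alpha>_def \<beta>_def by algebra
  finally have expand: "\<Delta>^3 * C X Y = s X Y * t X Y * (s X Y * \<alpha> + t X Y * \<beta>)" for X Y
    using C0[of 1] C0[of 2] by simp
  \<comment> \<open>The third and fourth zeros are independent of the first two, so \<open>s\<close>
    and \<open>t\<close> are nonzero there and only the linear factor can vanish. This gives two
    equations for \<open>\<alpha>\<close> and \<open>\<beta>\<close>.\<close>
  have lin: "s (x i) (y i) * \<alpha> + t (x i) (y i) * \<beta> = 0" if "i \<in> {3,4}" for i
    using expand[of "x i" "y i"] C0[of i] indep[of i 2] indep[of 1 i] that
    by (auto simp: s_def t_def)
  have "s (x 3) (y 3) * t (x 4) (y 4) - s (x 4) (y 4) * t (x 3) (y 3) = \<Delta> * (x 3 * y 4 - y 3 * x 4)"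
    by (simp add: s_def t_def \<Delta>_def algebra_simps)
  then have det: "s (x 3) (y 3) * t (x 4) (y 4) - s (x 4) (y 4) * t (x 3) (y 3) \<noteq> 0"
    using \<open>\<Delta> \<noteq> 0\<close> indep[of 3 4] by simp
  have "(s (x 3) (y 3) * t (x 4) (y 4) - s (x 4) (y 4) * t (x 3) (y 3)) * \<alpha> = 0"
    "(s (x 3) (y 3) * t (x 4) (y 4) - s (x 4) (y 4) * t (x 3) (y 3)) * \<beta> = 0"
    using lin[of 3] lin[of 4] by (simp; algebra)+
  with det have "\<alpha> = 0" "\<beta> = 0" by simp_all
  with expand \<open>\<Delta> \<noteq> 0\<close> have "C X Y = 0" for X Y by simp
  \<comment> \<open>The values at (1,0) and (0,1) are \<open>a\<close> and \<open>e\<close>; those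
    at (1,1) and (1,-1) then give b + c = 0 and c - b = 0.\<close>
  from this[of 1 0] this[of 0 1] this[of 1 1] this[of 1 "-1"] show ?thesis
    by (simp add: C_def)
qed

text \<open>The trace-free part of the difference tensor \<open>G - H\<close> is encoded by a binary cubic, which
  vanishes on the four differentials.\<close>

lemma difference_tensor_if_flex_conditions:
  fixes G H :: "2 \<Rightarrow> 2 \<Rightarrow> 2 \<Rightarrow> real" and F :: "nat \<Rightarrow> real^2 \<Rightarrow> real"
  assumes sym: "\<And>k i j. G k i j = G k j i" "\<And>k i j. H k i j = H k j i"
    and flex: "\<And>i. i \<in> {1..4} \<Longrightarrow> flex_condition G (F i) u \<and> flex_condition H (F i) u"
    and indep: "\<And>i j. i \<in> {1..4} \<Longrightarrow> j \<in> {1..4} \<Longrightarrow> i \<noteq> j \<Longrightarrow>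
      pd 1 (F i) u * pd 2 (F j) u - pd 2 (F i) u * pd 1 (F j) u \<noteq> 0"
    and \<rho>: "\<And>i. \<rho> i = (\<Sum>k\<in>UNIV. G k k i - H k k i) / 3"
  shows "G k i j - H k i j = (if k = i then \<rho> j else 0) + (if k = j then \<rho> i else 0)"
proof -
  define T where "T k i j = G k i j - H k i j" for k i j
  \<comment> \<open>The Hessian terms of the two flex conditions coincide and cancel. What remains
    is dF(T(w,w)) = 0, written out with \<open>w\<close> = (-F_2, F_1).\<close>
  have "T 1 2 2 * (pd 1 (F n) u)^3 + (T 2 2 2 - 2 * T 1 1 2) * (pd 1 (F n) u)\<^sup>2 * pd 2 (F n) u
    + (T 1 1 1 - 2 * T 2 1 2) * pd 1 (F n) u * (pd 2 (F n) u)\<^sup>2 + T 2 1 1 * (pd 2 (F n) u)^3 = 0"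
    if "n \<in> {1..4}" for n
    using flex[OF that] sym(1)[of _ 2 1] sym(2)[of _ 2 1]
    unfolding flex_condition_def Let_def T_def
    by (simp add: sum_2 algebra_simps power2_eq_square power3_eq_cube)
  from binary_cubic_eq_zero[OF this indep]
  have "T 1 2 2 = 0" "T 2 2 2 = 2 * T 1 1 2" "T 1 1 1 = 2 * T 2 1 2" "T 2 1 1 = 0" by auto
  moreover have "T 1 2 1 = T 1 1 2" "T 2 2 1 = T 2 1 2"
    using sym by (simp_all add: T_def)
  moreover have "\<rho> i = (T 1 1 i + T 2 2 i) / 3" for i
    by (simp add: \<rho> T_def sum_2)
  note this[of 1] this[of 2]
  ultimately have "\<forall>k i j. T k i j = (if k = i then \<rho> j else 0) + (if k = j then \<rho> i else 0)"
    by (simp add: forall_2)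
  then show ?thesis by (simp add: T_def)
qed

section \<open>Connections and projective equivalence as an equivalence relation\<close>

lemma connection_smooth:
  "connection M D \<Longrightarrow> c \<in> charts M \<Longrightarrow> smooth_on (snd c ` fst c) (D c k i j)"
  unfolding connection_def by blast

lemma connection_symmetric:
  "connection M D \<Longrightarrow> c \<in> charts M \<Longrightarrow> u \<in> snd c ` fst c \<Longrightarrow> D c k i j u = D c k j i u"
  unfolding connection_def by blast

lemma connection_transform:
  "connection M D \<Longrightarrow> c \<in> charts M \<Longrightarrow> e \<in> charts M \<Longrightarrow> u \<in> snd c ` (fst c \<inter> fst e) \<Longrightarrow>
    (\<Sum>k\<in>UNIV. D c k i j u * pd k (\<lambda>v. transition c e v $ l) u) =
        pd i (pd j (\<lambda>v. transition c e v $ l)) u +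
        (\<Sum>a\<in>UNIV. \<Sum>b\<in>UNIV. D e l a b (transition c e u) *
          pd i (\<lambda>v. transition c e v $ a) u * pd j (\<lambda>v. transition c e v $ b) u)"
  unfolding connection_def by blast

lemma one_form_diff:
  assumes "\<And>c. c \<in> charts M \<Longrightarrow> open (snd c ` fst c)" "one_form M \<rho>" "one_form M \<sigma>"
  shows "one_form M (\<lambda>c i u. \<rho> c i u - \<sigma> c i u)"
proof -
  have "smooth_on S (\<lambda>u. f u - h u)"
    if "open S" "smooth_on S f" "smooth_on S h" for S and f h :: "real^2 \<Rightarrow> real"
    using smooth_on_add[OF that(1,2) smooth_on_scaleR[OF that(1,3), of "-1"]] by simp
  with assms show ?thesis
    unfolding one_form_def by (auto simp: sum_subtractf right_diff_distrib)
qed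

lemma proj_equivalent_refl: "proj_equivalent M D D"
  unfolding proj_equivalent_def
  by (rule exI[of _ "\<lambda>c i u. 0"])
    (simp add: one_form_def smooth_on_const covector_apply_def)

text \<open>Subtracting the two one-forms proves this euclidean form; together with reflexivity it
  yields both symmetry and transitivity.\<close>

lemma proj_equivalent_euclidean:
  assumes charts: "\<And>c. c \<in> charts M \<Longrightarrow> open (snd c ` fst c)"
    and "proj_equivalent M D1 D2" "proj_equivalent M D1 D3"
  shows "proj_equivalent M D2 D3"
proof -
  have apply_diff: "covector_apply (\<lambda>c i u. \<sigma> c i u - \<rho> c i u) c X u
      = covector_apply \<sigma> c X u - covector_apply \<rho> c X u" for \<rho> \<sigma> :: "'a covector_field" and c X u
    by (simp add: covector_apply_def sum_subtractf left_diff_distrib)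
  obtain \<rho> where \<rho>: "one_form M \<rho>"
    "\<And>c X Y u. c \<in> charts M \<Longrightarrow> smooth_on (snd c ` fst c) X \<Longrightarrow> smooth_on (snd c ` fst c) Y \<Longrightarrow>
        u \<in> snd c ` fst c \<Longrightarrow> covariant_derivative D1 c X Y u - covariant_derivative D2 c X Y u =
           covector_apply \<rho> c X u *\<^sub>R Y u + covector_apply \<rho> c Y u *\<^sub>R X u"
    using assms(2) unfolding proj_equivalent_def by blast
  obtain \<sigma> where \<sigma>: "one_form M \<sigma>"
    "\<And>c X Y u. c \<in> charts M \<Longrightarrow> smooth_on (snd c ` fst c) X \<Longrightarrow> smooth_on (snd c ` fst c) Y \<Longrightarrow>
        u \<in> snd c ` fst c \<Longrightarrow> covariant_derivative D1 c X Y u - covariant_derivative D3 c X Y u =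
           covector_apply \<sigma> c X u *\<^sub>R Y u + covector_apply \<sigma> c Y u *\<^sub>R X u"
    using assms(3) unfolding proj_equivalent_def by blast
  let ?\<omega> = "\<lambda>c i u. \<sigma> c i u - \<rho> c i u"
  have "covariant_derivative D2 c X Y u - covariant_derivative D3 c X Y u =
      covector_apply ?\<omega> c X u *\<^sub>R Y u + covector_apply ?\<omega> c Y u *\<^sub>R X u"
    if "c \<in> charts M" "smooth_on (snd c ` fst c) X" "smooth_on (snd c ` fst c) Y" "u \<in> snd c ` fst c"
    for c X Y u
  proof -
    have "covariant_derivative D2 c X Y u - covariant_derivative D3 c X Y u =
        (covariant_derivative D1 c X Y u - covariant_derivative D3 c X Y u) -
        (covariant_derivative D1 c X Y u - covariant_derivative D2 c X Y u)" by simp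
    also have "\<dots> = covector_apply ?\<omega> c X u *\<^sub>R Y u + covector_apply ?\<omega> c Y u *\<^sub>R X u"
      unfolding \<rho>(2)[OF that] \<sigma>(2)[OF that] apply_diff by (simp add: algebra_simps)
    finally show ?thesis .
  qed
  moreover have "one_form M ?\<omega>" using charts \<sigma>(1) \<rho>(1) by (rule one_form_diff)
  ultimately show ?thesis unfolding proj_equivalent_def by blast
qed

lemma proj_equivalent_sym:
  assumes "\<And>c. c \<in> charts M \<Longrightarrow> open (snd c ` fst c)" "proj_equivalent M D1 D2"
  shows "proj_equivalent M D2 D1"
  using assms(1) assms(2) proj_equivalent_refl by (rule proj_equivalent_euclidean)

lemma proj_equivalent_trans:
  assumes "\<And>c. c \<in> charts M \<Longrightarrow> open (snd c ` fst c)"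
    and "proj_equivalent M D1 D2" "proj_equivalent M D2 D3"
  shows "proj_equivalent M D1 D3"
  using assms(1) proj_equivalent_sym[OF assms(1,2)] assms(3) by (rule proj_equivalent_euclidean)

lemma proj_class_eq:
  assumes "\<And>c. c \<in> charts M \<Longrightarrow> open (snd c ` fst c)" "proj_equivalent M D1 D2"
  shows "proj_class M D1 = proj_class M D2"
proof -
  have "proj_equivalent M D1 D \<longleftrightarrow> proj_equivalent M D2 D" for D
    using proj_equivalent_euclidean[OF assms(1,2), of D] proj_equivalent_trans[OF assms(1,2), of D]
    by blast
  then show ?thesis by (simp add: proj_class_def)
qed

text \<open>Passage from pointwise algebra to a global one-form. The functions \<open>F\<close> may
  change with the chart and the point, since they only serve to determine the difference of the two
  connections at that point.\<close>

lemma proj_equivalent_if_flex_conditions: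
  assumes charts: "\<And>c. c \<in> charts M \<Longrightarrow> is_chart T c"
    and compat: "\<And>c e. c \<in> charts M \<Longrightarrow> e \<in> charts M \<Longrightarrow> compatible c e"
    and conn: "connection M D1" "connection M D2"
    and flex: "\<And>c p. c \<in> charts M \<Longrightarrow> p \<in> fst c \<Longrightarrow> \<exists>F.
      (\<forall>i\<in>{1..4::nat}. flex_condition (\<lambda>k i j. D1 c k i j (snd c p)) (F i) (snd c p) \<and>
         flex_condition (\<lambda>k i j. D2 c k i j (snd c p)) (F i) (snd c p)) \<and>
      (\<forall>i\<in>{1..4}. \<forall>j\<in>{1..4}. i \<noteq> j \<longrightarrow>
         pd 1 (F i) (snd c p) * pd 2 (F j) (snd c p)
         - pd 2 (F i) (snd c p) * pd 1 (F j) (snd c p) \<noteq> 0)"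
  shows "proj_equivalent M D1 D2"
proof -
  \<comment> \<open>Contracting k with i in \<open>\<delta>\<^sup>k\<^sub>i \<rho>\<^sub>j +
    \<delta>\<^sup>k\<^sub>j \<rho>\<^sub>i\<close> gives 2 + 1 = 3 times the covector, hence the
    division by 3.\<close>
  define \<rho> where "\<rho> c i u = (\<Sum>k\<in>UNIV. D1 c k k i u - D2 c k k i u) / 3" for c i u
  have diff: "D1 c k i j u - D2 c k i j u = (if k = i then \<rho> c j u else 0) + (if k = j then \<rho> c i u else 0)"
    if c: "c \<in> charts M" and u: "u \<in> snd c ` fst c" for c k i j u
  proof -
    obtain p where p: "p \<in> fst c" "u = snd c p" using u by blast
    obtain F where F: "\<And>i. i \<in> {1..4::nat} \<Longrightarrow> flex_condition (\<lambda>k i j. D1 c k i j u) (F i) u \<and>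
         flex_condition (\<lambda>k i j. D2 c k i j u) (F i) u"
      "\<And>i j. i \<in> {1..4} \<Longrightarrow> j \<in> {1..4} \<Longrightarrow> i \<noteq> j \<Longrightarrow>
         pd 1 (F i) u * pd 2 (F j) u - pd 2 (F i) u * pd 1 (F j) u \<noteq> 0"
      using flex[OF c p(1)] unfolding p(2) by blast
    show ?thesis
      by (rule difference_tensor_if_flex_conditions[where F = F and \<rho> = "\<lambda>i. \<rho> c i u",
            OF connection_symmetric[OF conn(1) c u] connection_symmetric[OF conn(2) c u] F])
        (simp_all add: \<rho>_def)
  qed
  have "one_form M \<rho>"
    unfolding one_form_def
  proof (intro conjI ballI allI)
    fix c and i :: 2 assume c: "c \<in> charts M"
    have "open (snd c ` fst c)" using charts[OF c] by (simp add: is_chart_def)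
    then have "smooth_on (snd c ` fst c) (\<lambda>u. (1/3) *\<^sub>R ((D1 c 1 1 i u + D1 c 2 2 i u) +
        (-1) *\<^sub>R (D2 c 1 1 i u + D2 c 2 2 i u)))"
      by (intro smooth_on_scaleR smooth_on_add connection_smooth[OF conn(1) c]
          connection_smooth[OF conn(2) c])
    moreover have "(\<lambda>u. (1/3) *\<^sub>R ((D1 c 1 1 i u + D1 c 2 2 i u) +
        (-1) *\<^sub>R (D2 c 1 1 i u + D2 c 2 2 i u))) = \<rho> c i"
      by (auto simp: \<rho>_def fun_eq_iff sum_2)
    ultimately show "smooth_on (snd c ` fst c) (\<rho> c i)" by simp
  next
    fix c e u and i :: 2
    assume c: "c \<in> charts M" and e: "e \<in> charts M" and u: "u \<in> snd c ` (fst c \<inter> fst e)"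
    define J where "J l i = pd i (\<lambda>v. transition c e v $ l) u" for l i
    \<comment> \<open>\<open>\<omega>\<close> measures the failure of the transformation law.
      Subtracting the laws of the two connections cancels the second derivatives of the transition
      map, and inserting the trace form of the difference in both charts leaves a linear relation
      between \<open>\<omega>\<close> and the Jacobian.\<close>
    define \<omega> where "\<omega> i = \<rho> c i u - (\<Sum>a\<in>UNIV. J a i * \<rho> e a (transition c e u))" for i
    have uc: "u \<in> snd c ` fst c" using u by blast
    have ue: "transition c e u \<in> snd e ` fst e"
      using u by (elim imageE) (simp add: transition_apply[OF charts[OF c]])
    have "\<omega> j * J l i + \<omega> i * J l j = 0" for l i j
    proof -
      have "(\<Sum>k\<in>UNIV. (D1 c k i j u - D2 c k i j u) * J l k) =
        (\<Sum>a\<in>UNIV. \<Sum>b\<in>UNIV. (D1 e l a b (transition c e u) - D2 e l a b (transition c e u)) *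
          J a i * J b j)"
        using connection_transform[OF conn(1) c e u, of i j l]
          connection_transform[OF conn(2) c e u, of i j l]
        by (simp add: J_def sum_2 algebra_simps)
      then show ?thesis
        unfolding diff[OF c uc] diff[OF e ue] \<omega>_def
        using exhaust_2[of i] exhaust_2[of j] exhaust_2[of l]
        by (auto simp: sum_2 algebra_simps)
    qed
    note * = this
    obtain a b where nz: "J a b \<noteq> 0"
      using transition_jacobian_nonzero[OF charts[OF c] charts[OF e] compat[OF c e] u]
      by (auto simp: J_def)
    \<comment> \<open>With both lower indices equal to \<open>b\<close> the relation reads 2
      \<open>\<omega> b\<close> \<open>J a b\<close> = 0; with one of them equal to \<open>b\<close>
      it then kills the other component.\<close>
    have "\<omega> b = 0" using *[of b a b] nz by simp
    with *[of i a b] nz have "\<omega> i = 0" by simp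
    then show "\<rho> c i u = (\<Sum>a\<in>UNIV. pd i (\<lambda>v. transition c e v $ a) u * \<rho> e a (transition c e u))"
      by (simp add: \<omega>_def J_def)
  qed
  moreover have "covariant_derivative D1 c X Y u - covariant_derivative D2 c X Y u =
      covector_apply \<rho> c X u *\<^sub>R Y u + covector_apply \<rho> c Y u *\<^sub>R X u"
    if "c \<in> charts M" "u \<in> snd c ` fst c" for c X Y u
  proof -
    have eq: "D1 c k i j u = D2 c k i j u + (if k = i then \<rho> c j u else 0) + (if k = j then \<rho> c i u else 0)"
      for k i j using diff[OF that, of k i j] by linarith
    show ?thesis
      unfolding covariant_derivative_def covector_apply_def vec_eq_iff eq
      by (simp add: forall_2 sum_2 algebra_simps)
  qed
  ultimately show ?thesis unfolding proj_equivalent_def by blast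
qed

section \<open>Transport by a diffeomorphism\<close>

text \<open>The chart of the target in which the image of p has the coordinates that p has in
  \<open>c\<close>. In these coordinates the mapping is the identity, so components can be compared
  directly.\<close>

definition push_chart :: "'a set \<Rightarrow> ('a \<Rightarrow> 'b) \<Rightarrow> 'a chart \<Rightarrow> 'b chart" where
  "push_chart V \<phi> c = (\<phi> ` fst c, snd c \<circ> inv_into V \<phi>)"

lemma pullback_eq: "pullback V \<phi> D c = D (push_chart V \<phi> c)"
  by (simp add: pullback_def push_chart_def)

lemma diffeo_on_inj_on:
  assumes "diffeo_on M V \<phi> M'"
  shows "inj_on \<phi> V"
proof -
  have "topspace (subtopology (topo M) V) = V"
    using assms by (meson diffeo_on_def openin_subset topspace_subtopology_subset)
  then show ?thesis
    using assms homeomorphic_imp_injective_map unfolding diffeo_on_def by metis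
qed

lemma
  assumes "inj_on \<phi> V"
  shows push_chart_image: "A \<subseteq> V \<Longrightarrow> snd (push_chart V \<phi> c) ` (\<phi> ` A) = snd c ` A"
    and push_chart_Int: "fst c \<subseteq> V \<Longrightarrow> fst e \<subseteq> V \<Longrightarrow>
      fst (push_chart V \<phi> c) \<inter> fst (push_chart V \<phi> e) = \<phi> ` (fst c \<inter> fst e)"
    and push_chart_apply: "p \<in> V \<Longrightarrow> snd (push_chart V \<phi> c) (\<phi> p) = snd c p"
proof -
  show image: "snd (push_chart V \<phi> c) (\<phi> p) = snd c p" if "p \<in> V" for p
    using assms that by (simp add: push_chart_def)
  show "snd (push_chart V \<phi> c) ` (\<phi> ` A) = snd c ` A" if "A \<subseteq> V"
    unfolding image_image using that image by (intro image_cong) auto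
  show "fst (push_chart V \<phi> c) \<inter> fst (push_chart V \<phi> e) = \<phi> ` (fst c \<inter> fst e)"
    if "fst c \<subseteq> V" "fst e \<subseteq> V"
    using inj_on_image_Int[OF assms that] by (simp add: push_chart_def)
qed

text \<open>This is what gives \<open>pullback\<close> a meaning: a connection is controlled only on
  charts of the atlas. By maximality it suffices that the transported chart is a chart and is
  compatible with every chart of the target, and the latter is the smoothness of the diffeomorphism
  in coordinates.\<close>

lemma push_chart_in_charts:
  assumes M': "smooth_surface M'" and diffeo: "diffeo_on M V \<phi> M'"
    and c: "c \<in> charts M" "is_chart (topo M) c" "fst c \<subseteq> V"
  shows "push_chart V \<phi> c \<in> charts M'"
proof -
  let ?c = "push_chart V \<phi> c"
  note inj = diffeo_on_inj_on[OF diffeo]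
  have img: "snd ?c ` fst ?c = snd c ` fst c"
    using push_chart_image[OF inj c(3), of c] by (simp add: push_chart_def)
  have V: "openin (topo M) V" "openin (topo M') (\<phi> ` V)" and
    hom: "homeomorphic_map (subtopology (topo M) V) (subtopology (topo M') (\<phi> ` V)) \<phi>"
    using diffeo by (auto simp: diffeo_on_def)
  have "openin (subtopology (topo M) V) (fst c)"
    using is_chartD(1)[OF c(2)] c(3) V(1) by (simp add: openin_open_subtopology)
  then have "openin (subtopology (topo M') (\<phi> ` V)) (\<phi> ` fst c)"
    using homeomorphic_imp_open_map[OF hom] by (simp add: open_map_def)
  then have o: "openin (topo M') (\<phi> ` fst c)"
    using V(2) by (simp add: openin_open_subtopology)
  have tops: "topspace (subtopology (topo M) V) = V" "topspace (subtopology (topo M') (\<phi> ` V)) = \<phi> ` V"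
    "topspace (subtopology (topo M) (fst c)) = fst c"
    "topspace (subtopology (topo M') (\<phi> ` fst c)) = \<phi> ` fst c"
    using V is_chartD(1)[OF c(2)] o by (meson openin_subset topspace_subtopology_subset)+
  have "V \<inter> fst c = fst c" "\<phi> ` V \<inter> \<phi> ` fst c = \<phi> ` fst c" using c(3) by auto
  then have "homeomorphic_map (subtopology (topo M) (fst c)) (subtopology (topo M') (\<phi> ` fst c)) \<phi>"
    using homeomorphic_map_subtopologies[OF hom, unfolded tops subtopology_subtopology,
        of "fst c" "\<phi> ` fst c"] by simp
  then obtain \<psi> where
    "homeomorphic_maps (subtopology (topo M) (fst c)) (subtopology (topo M') (\<phi> ` fst c)) \<phi> \<psi>"
    by (rule homeomorphic_map_maps[THEN iffD1, THEN exE])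
  then have \<psi>:
    "homeomorphic_map (subtopology (topo M') (\<phi> ` fst c)) (subtopology (topo M) (fst c)) \<psi>"
    "\<forall>p\<in>fst c. \<psi> (\<phi> p) = p"
    unfolding homeomorphic_maps_map tops by blast+
  \<comment> \<open>The inverse \<open>\<psi>\<close> is replaced by
    \<open>inv_into V \<phi>\<close>, which occurs in the transported chart; they agree on the image
    of the chart domain.\<close>
  have "homeomorphic_map (subtopology (topo M') (\<phi> ` fst c)) (subtopology (topo M) (fst c)) (inv_into V \<phi>)"
    by (rule homeomorphic_map_eq[OF \<psi>(1)]) (use \<psi>(2) inj c(3) in \<open>auto simp: tops subset_iff\<close>)
  moreover have "homeomorphic_map (subtopology (topo M) (fst c)) (top_of_set (snd c ` fst c)) (snd c)"
    "open (snd c ` fst c)"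
    using c(2) by (simp_all add: is_chart_def)
  ultimately have chart: "is_chart (topo M') ?c"
    using homeomorphic_map_compose o img by (auto simp: is_chart_def push_chart_def)
  have "compatible ?c e" if e: "e \<in> charts M'" for e
  proof -
    have echart: "is_chart (topo M') e" using M' e by (simp add: smooth_surface_def)
    have smooth: "smooth_on (snd c ` {p\<in>fst c \<inter> V. \<phi> p \<in> fst e}) (snd e \<circ> \<phi> \<circ> inv_into (fst c) (snd c))"
      "smooth_on (snd e ` {q\<in>fst e \<inter> \<phi> ` V. inv_into V \<phi> q \<in> fst c})
          (snd c \<circ> inv_into V \<phi> \<circ> inv_into (fst e) (snd e))"
      using diffeo c(1) e by (auto simp: diffeo_on_def)
    have set1: "snd ?c ` (fst ?c \<inter> fst e) = snd c ` {p\<in>fst c \<inter> V. \<phi> p \<in> fst e}"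
    proof -
      have "fst ?c \<inter> fst e = \<phi> ` {p\<in>fst c \<inter> V. \<phi> p \<in> fst e}"
        using c(3) by (auto simp: push_chart_def)
      moreover have "{p\<in>fst c \<inter> V. \<phi> p \<in> fst e} \<subseteq> V" by blast
      ultimately show ?thesis by (simp only: push_chart_image[OF inj])
    qed
    have set2: "fst ?c \<inter> fst e = {q\<in>fst e \<inter> \<phi> ` V. inv_into V \<phi> q \<in> fst c}"
      using c(3) inj by (auto simp: push_chart_def)
    have op: "open (snd ?c ` (fst ?c \<inter> fst e))"
      using o is_chartD(1)[OF echart]
      by (intro is_chart_open_image[OF chart]) (auto simp: push_chart_def)
    \<comment> \<open>The two inverses of coordinate maps are chosen separately, so the functions
      are compared only on the overlap, which is open.\<close>
    have "smooth_on (snd ?c ` (fst ?c \<inter> fst e)) (transition ?c e)"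
    proof (rule smooth_on_cong[OF op, THEN iffD1])
      show "smooth_on (snd ?c ` (fst ?c \<inter> fst e)) (snd e \<circ> \<phi> \<circ> inv_into (fst c) (snd c))"
        using smooth(1) by (simp add: set1)
      fix u assume "u \<in> snd ?c ` (fst ?c \<inter> fst e)"
      then obtain p where p: "p \<in> fst c" "u = snd c p" unfolding set1 by blast
      then have u: "u = snd ?c (\<phi> p)" using push_chart_apply[OF inj, of p c] c(3) by auto
      have "transition ?c e u = snd e (\<phi> p)"
        unfolding u by (rule transition_apply[OF chart]) (simp add: push_chart_def p)
      then show "(snd e \<circ> \<phi> \<circ> inv_into (fst c) (snd c)) u = transition ?c e u"
        using p is_chartD(2)[OF c(2)] by simp
    qed
    moreover have "transition e ?c = snd c \<circ> inv_into V \<phi> \<circ> inv_into (fst e) (snd e)"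
      by (simp add: transition_def push_chart_def)
    ultimately show ?thesis
      using smooth(2) by (simp add: compatible_def set2)
  qed
  with chart M' show ?thesis unfolding smooth_surface_def by blast
qed

lemma transition_push_chart:
  assumes "is_chart T c" "is_chart T' (push_chart V \<phi> c)" "inj_on \<phi> V" "fst c \<subseteq> V" "fst e \<subseteq> V"
    and "u \<in> snd c ` (fst c \<inter> fst e)"
  shows "transition (push_chart V \<phi> c) (push_chart V \<phi> e) u = transition c e u"
proof -
  obtain p where p: "p \<in> fst c" "p \<in> fst e" "u = snd c p" using assms(6) by blast
  then have u: "u = snd (push_chart V \<phi> c) (\<phi> p)"
    using push_chart_apply[OF assms(3), of p c] p assms(4) by auto
  have "transition (push_chart V \<phi> c) (push_chart V \<phi> e) u = snd (push_chart V \<phi> e) (\<phi> p)"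
    unfolding u by (rule transition_apply[OF assms(2)]) (simp add: push_chart_def p)
  also have "\<dots> = snd e p"
    using p assms(5) by (intro push_chart_apply[OF assms(3)]) auto
  finally show ?thesis
    using transition_apply[OF assms(1) p(1)] p(3) by simp
qed

section \<open>Restriction to open sets and pullback of connections and one-forms\<close>

lemma charts_restrict_surface: "c \<in> charts (restrict_surface M V) \<longleftrightarrow> c \<in> charts M \<and> fst c \<subseteq> V"
  by (simp add: restrict_surface_def)

lemma connection_restrict_surface: "connection M D \<Longrightarrow> connection (restrict_surface M V) D"
  by (simp add: connection_def charts_restrict_surface)

lemma proj_equivalent_restrict_surface:
  "proj_equivalent M D D' \<Longrightarrow> proj_equivalent (restrict_surface M V) D D'"
  unfolding proj_equivalent_def one_form_def
  by (erule ex_forward) (simp add: charts_restrict_surface)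

lemma smooth_surface_is_chart: "smooth_surface M \<Longrightarrow> c \<in> charts M \<Longrightarrow> is_chart (topo M) c"
  by (simp add: smooth_surface_def)

lemma smooth_surface_open: "smooth_surface M \<Longrightarrow> c \<in> charts M \<Longrightarrow> open (snd c ` fst c)"
  by (simp add: smooth_surface_def is_chart_def)

context
  fixes M :: "'a surface" and M' :: "'b surface" and V \<phi>
  assumes M: "smooth_surface M" and M': "smooth_surface M'" and diffeo: "diffeo_on M V \<phi> M'"
begin

private lemma push:
  assumes "c \<in> charts (restrict_surface M V)"
  shows "push_chart V \<phi> c \<in> charts M'"
    and "snd (push_chart V \<phi> c) ` fst (push_chart V \<phi> c) = snd c ` fst c"
proof -
  have c: "c \<in> charts M" "fst c \<subseteq> V" using assms by (simp_all add: charts_restrict_surface)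
  show "push_chart V \<phi> c \<in> charts M'"
    using M' diffeo c(1) smooth_surface_is_chart[OF M c(1)] c(2) by (rule push_chart_in_charts)
  show "snd (push_chart V \<phi> c) ` fst (push_chart V \<phi> c) = snd c ` fst c"
    using push_chart_image[OF diffeo_on_inj_on[OF diffeo] c(2), of c] by (simp add: push_chart_def)
qed

text \<open>Transition maps of transported charts are the original ones on the overlap, so every
  transformation law on the target becomes one on the source.\<close>

private lemma push2:
  assumes c: "c \<in> charts (restrict_surface M V)" and e: "e \<in> charts (restrict_surface M V)"
    and u: "u \<in> snd c ` (fst c \<inter> fst e)"
  shows "u \<in> snd (push_chart V \<phi> c) ` (fst (push_chart V \<phi> c) \<inter> fst (push_chart V \<phi> e))"
    and "transition (push_chart V \<phi> c) (push_chart V \<phi> e) u = transition c e u"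
    and "pd i (\<lambda>v. transition (push_chart V \<phi> c) (push_chart V \<phi> e) v $ a) u
      = pd i (\<lambda>v. transition c e v $ a) u"
    and "pd i (pd j (\<lambda>v. transition (push_chart V \<phi> c) (push_chart V \<phi> e) v $ a)) u
      = pd i (pd j (\<lambda>v. transition c e v $ a)) u"
proof -
  let ?S = "snd c ` (fst c \<inter> fst e)"
  note inj = diffeo_on_inj_on[OF diffeo]
  have ce: "c \<in> charts M" "e \<in> charts M" "fst c \<subseteq> V" "fst e \<subseteq> V"
    using c e by (simp_all add: charts_restrict_surface)
  note chart = smooth_surface_is_chart[OF M ce(1)] smooth_surface_is_chart[OF M ce(2)]
  have S: "open ?S"
    using chart by (intro is_chart_open_image[of "topo M"] openin_Int is_chartD(1)) auto
  show "u \<in> snd (push_chart V \<phi> c) ` (fst (push_chart V \<phi> c) \<inter> fst (push_chart V \<phi> e))"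
    unfolding push_chart_Int[OF inj ce(3,4)]
    using u ce(3) push_chart_image[OF inj, of "fst c \<inter> fst e" c] by blast
  have eq: "transition (push_chart V \<phi> c) (push_chart V \<phi> e) u = transition c e u" if "u \<in> ?S" for u
    using chart(1) smooth_surface_is_chart[OF M' push(1)[OF c]] inj ce(3,4) that
    by (rule transition_push_chart)
  from u show "transition (push_chart V \<phi> c) (push_chart V \<phi> e) u = transition c e u"
    by (rule eq)
  \<comment> \<open>Agreement on the whole overlap, and not only at the given point, is what the
    second derivatives require.\<close>
  have pd1: "pd i (\<lambda>v. transition (push_chart V \<phi> c) (push_chart V \<phi> e) v $ a) u
      = pd i (\<lambda>v. transition c e v $ a) u" if "u \<in> ?S" for i u
    using S that by (rule pd_cong_open) (simp add: eq)
  from u show "pd i (\<lambda>v. transition (push_chart V \<phi> c) (push_chart V \<phi> e) v $ a) u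
      = pd i (\<lambda>v. transition c e v $ a) u"
    by (rule pd1)
  show "pd i (pd j (\<lambda>v. transition (push_chart V \<phi> c) (push_chart V \<phi> e) v $ a)) u
      = pd i (pd j (\<lambda>v. transition c e v $ a)) u"
    using S u by (rule pd_cong_open) (rule pd1)
qed

lemma connection_pullback:
  assumes "connection M' D"
  shows "connection (restrict_surface M V) (pullback V \<phi> D)"
  unfolding connection_def
proof (intro conjI ballI allI)
  fix c and k i j :: 2 assume c: "c \<in> charts (restrict_surface M V)"
  show "smooth_on (snd c ` fst c) (pullback V \<phi> D c k i j)"
    using connection_smooth[OF assms push(1)[OF c]] by (simp add: push(2)[OF c] pullback_eq)
next
  fix c u and k i j :: 2 assume c: "c \<in> charts (restrict_surface M V)" and "u \<in> snd c ` fst c"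
  then show "pullback V \<phi> D c k i j u = pullback V \<phi> D c k j i u"
    using connection_symmetric[OF assms push(1)[OF c]] by (simp add: push(2)[OF c] pullback_eq)
next
  fix c e u and l i j :: 2
  assume *: "c \<in> charts (restrict_surface M V)" "e \<in> charts (restrict_surface M V)"
    "u \<in> snd c ` (fst c \<inter> fst e)"
  show "(\<Sum>k\<in>UNIV. pullback V \<phi> D c k i j u * pd k (\<lambda>v. transition c e v $ l) u) =
        pd i (pd j (\<lambda>v. transition c e v $ l)) u +
        (\<Sum>a\<in>UNIV. \<Sum>b\<in>UNIV. pullback V \<phi> D e l a b (transition c e u) *
          pd i (\<lambda>v. transition c e v $ a) u * pd j (\<lambda>v. transition c e v $ b) u)"
    using connection_transform[OF assms push(1)[OF *(1)] push(1)[OF *(2)] push2(1)[OF *], of i j l]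
    unfolding push2(2-4)[OF *] by (simp only: pullback_eq)
qed

lemma proj_equivalent_pullback:
  assumes "proj_equivalent M' D D'"
  shows "proj_equivalent (restrict_surface M V) (pullback V \<phi> D) (pullback V \<phi> D')"
proof -
  obtain \<rho> where \<rho>: "one_form M' \<rho>"
    "\<And>c X Y u. c \<in> charts M' \<Longrightarrow> smooth_on (snd c ` fst c) X \<Longrightarrow> smooth_on (snd c ` fst c) Y \<Longrightarrow>
        u \<in> snd c ` fst c \<Longrightarrow> covariant_derivative D c X Y u - covariant_derivative D' c X Y u =
           covector_apply \<rho> c X u *\<^sub>R Y u + covector_apply \<rho> c Y u *\<^sub>R X u"
    using assms unfolding proj_equivalent_def by blast
  \<comment> \<open>The pullback of the one-form, encoded as \<open>pullback\<close> is for
    connections.\<close>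
  let ?\<rho> = "\<lambda>c. \<rho> (push_chart V \<phi> c)"
  have "one_form (restrict_surface M V) ?\<rho>"
    unfolding one_form_def
  proof (intro conjI ballI allI)
    fix c and i :: 2 assume c: "c \<in> charts (restrict_surface M V)"
    show "smooth_on (snd c ` fst c) (?\<rho> c i)"
      using \<rho>(1) push[OF c] unfolding one_form_def by metis
  next
    fix c e u and i :: 2
    assume *: "c \<in> charts (restrict_surface M V)" "e \<in> charts (restrict_surface M V)"
      "u \<in> snd c ` (fst c \<inter> fst e)"
    have "?\<rho> c i u = (\<Sum>a\<in>UNIV. pd i (\<lambda>v. transition (push_chart V \<phi> c) (push_chart V \<phi> e) v $ a) u *
        ?\<rho> e a (transition (push_chart V \<phi> c) (push_chart V \<phi> e) u))"
      using \<rho>(1) push(1)[OF *(1)] push(1)[OF *(2)] push2(1)[OF *] unfolding one_form_def by blast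
    then show "?\<rho> c i u = (\<Sum>a\<in>UNIV. pd i (\<lambda>v. transition c e v $ a) u * ?\<rho> e a (transition c e u))"
      unfolding push2(2-4)[OF *] .
  qed
  moreover have "covariant_derivative (pullback V \<phi> D) c X Y u -
      covariant_derivative (pullback V \<phi> D') c X Y u =
      covector_apply ?\<rho> c X u *\<^sub>R Y u + covector_apply ?\<rho> c Y u *\<^sub>R X u"
    if "c \<in> charts (restrict_surface M V)" "smooth_on (snd c ` fst c) X"
      "smooth_on (snd c ` fst c) Y" "u \<in> snd c ` fst c" for c X Y u
    using \<rho>(2)[OF push(1)[OF that(1)], unfolded push(2)[OF that(1)], OF that(2-4)]
    by (simp add: covariant_derivative_def covector_apply_def pullback_eq)
  ultimately show ?thesis unfolding proj_equivalent_def by blast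
qed

end

section \<open>The projective structure of a geodesic web\<close>

lemma foliation_submersion: "foliation M F \<Longrightarrow> (U, f) \<in> F \<Longrightarrow> submersion M U f"
  by (auto simp: foliation_def)

lemma foliation_cover:
  assumes "smooth_surface M" "foliation M F" "c \<in> charts M" "p \<in> fst c"
  shows "\<exists>U f. (U, f) \<in> F \<and> p \<in> U"
proof -
  have "p \<in> topspace (topo M)" using assms(1,3,4) by (auto simp: smooth_surface_def)
  also have "\<dots> = (\<Union>(U, f)\<in>F. U)" using assms(2) by (simp add: foliation_def)
  finally show ?thesis by auto
qed

lemma submersionD:
  assumes "submersion M U f" "c \<in> charts M"
  shows "openin (topo M) U" "smooth_on (snd c ` (fst c \<inter> U)) (coord c f)"
  using assms by (auto simp: submersion_def)

lemma flex_condition_leaf: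
  assumes M: "smooth_surface M" and W: "web M d W" "leaves_geodesic M D d W"
    and f: "i \<in> {1..d}" "(U, f) \<in> W i" "p \<in> U" and c: "c \<in> charts M" "p \<in> fst c"
  shows "flex_condition (\<lambda>k i j. D c k i j (snd c p)) (coord c f) (snd c p)"
proof -
  obtain \<epsilon> \<gamma> where \<gamma>: "\<epsilon> > 0" "geodesic M D {-\<epsilon><..<\<epsilon>} \<gamma>" "\<gamma> 0 = p"
    "\<forall>t\<in>{-\<epsilon><..<\<epsilon>}. \<gamma> t \<in> U \<and> f (\<gamma> t) = f p"
    using W(2) f unfolding leaves_geodesic_def by blast
  note chart = smooth_surface_is_chart[OF M c(1)]
  have "foliation M (W i)" using W(1) f(1) by (simp add: web_def)
  note sub = submersionD[OF foliation_submersion[OF this f(2)] c(1)]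
  show ?thesis
    by (rule flex_condition_if_level_geodesic[OF \<gamma>(2,1) c(1) chart _ sub(1) _ sub(2), where k = "f p"])
      (use \<gamma> f(3) c(2) coord_apply[OF chart] in auto)
qed

lemma web_independent:
  assumes "web M d W" "i \<in> {1..d}" "j \<in> {1..d}" "i \<noteq> j" "(U, f) \<in> W i" "(V, h) \<in> W j"
    and "c \<in> charts M" "p \<in> fst c" "p \<in> U" "p \<in> V"
  shows "pd 1 (coord c f) (snd c p) * pd 2 (coord c h) (snd c p)
    - pd 2 (coord c f) (snd c p) * pd 1 (coord c h) (snd c p) \<noteq> 0"
  using assms unfolding web_def by blast

text \<open>Uniqueness of the projective structure: the flex conditions of both connections hold for
  the same web functions, and four of these are in general position.\<close>

lemma geodesic_web_connections_proj_equivalent: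
  assumes M: "smooth_surface M" and d: "d \<ge> 4" and W: "web M d W"
    and D: "connection M D" "leaves_geodesic M D d W"
    and D': "connection M D'" "leaves_geodesic M D' d W"
  shows "proj_equivalent M D D'"
proof (rule proj_equivalent_if_flex_conditions[OF smooth_surface_is_chart[OF M] _ D(1) D'(1)])
  show "compatible c e" if "c \<in> charts M" "e \<in> charts M" for c e
    using M that by (simp add: smooth_surface_def)
  fix c p assume c: "c \<in> charts M" "p \<in> fst c"
  have "\<forall>i\<in>{1..d}. \<exists>U f. (U, f) \<in> W i \<and> p \<in> U"
    using foliation_cover[OF M _ c] W by (simp add: web_def)
  then obtain U f where Uf: "\<And>i. i \<in> {1..d} \<Longrightarrow> (U i, f i) \<in> W i \<and> p \<in> U i"
    by metis
  show "\<exists>F. (\<forall>i\<in>{1..4::nat}. flex_condition (\<lambda>k i j. D c k i j (snd c p)) (F i) (snd c p) \<and>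
         flex_condition (\<lambda>k i j. D' c k i j (snd c p)) (F i) (snd c p)) \<and>
      (\<forall>i\<in>{1..4}. \<forall>j\<in>{1..4}. i \<noteq> j \<longrightarrow>
         pd 1 (F i) (snd c p) * pd 2 (F j) (snd c p)
         - pd 2 (F i) (snd c p) * pd 1 (F j) (snd c p) \<noteq> 0)"
  proof (intro exI[of _ "\<lambda>i. coord c (f i)"] conjI ballI impI)
    fix i :: nat assume "i \<in> {1..4}"
    then have i: "i \<in> {1..d}" using d by simp
    show "flex_condition (\<lambda>k i j. D c k i j (snd c p)) (coord c (f i)) (snd c p)"
      "flex_condition (\<lambda>k i j. D' c k i j (snd c p)) (coord c (f i)) (snd c p)"
      using flex_condition_leaf[OF M W _ i _ _ c] D(2) D'(2) Uf[OF i] by blast+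
    fix j assume "j \<in> {1..4::nat}" and ij: "i \<noteq> j"
    then have j: "j \<in> {1..d}" using d by simp
    note Ui = Uf[OF i, THEN conjunct1] Uf[OF i, THEN conjunct2]
    note Uj = Uf[OF j, THEN conjunct1] Uf[OF j, THEN conjunct2]
    show "pd 1 (coord c (f i)) (snd c p) * pd 2 (coord c (f j)) (snd c p) -
        pd 2 (coord c (f i)) (snd c p) * pd 1 (coord c (f j)) (snd c p) \<noteq> 0"
      using web_independent[OF W i j ij Ui(1) Uj(1) c Ui(2) Uj(2)] .
  qed
qed

text \<open>Resolves the definite description: the class may be computed from any connection for
  which the leaves are geodesics.\<close>

lemma web_projective_structure_eq:
  assumes M: "smooth_surface M" and d: "d \<ge> 4" and W: "web M d W"
    and D: "connection M D" "leaves_geodesic M D d W"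
  shows "web_projective_structure M d W = proj_class M D"
  unfolding web_projective_structure_def
proof (rule the_equality)
  have "D \<in> proj_class M D" using D(1) proj_equivalent_refl by (simp add: proj_class_def)
  with D show "projective_structure M (proj_class M D) \<and>
      (\<exists>D'\<in>proj_class M D. leaves_geodesic M D' d W)"
    unfolding projective_structure_def by blast
next
  fix P assume "projective_structure M P \<and> (\<exists>D'\<in>P. leaves_geodesic M D' d W)"
  then obtain E D' where P: "P = proj_class M E" and D': "D' \<in> proj_class M E" "leaves_geodesic M D' d W"
    unfolding projective_structure_def by blast
  have "proj_equivalent M D' D"
    using M d W _ D'(2) D by (rule geodesic_web_connections_proj_equivalent)
      (use D'(1) in \<open>simp add: proj_class_def\<close>)
  moreover have "proj_equivalent M E D'" using D'(1) by (simp add: proj_class_def)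
  ultimately show "P = proj_class M D"
    unfolding P using smooth_surface_open[OF M]
    by (metis proj_class_eq)
qed

text \<open>A geodesic in a leaf of \<open>W\<close> runs in a level set of \<open>h \<circ> \<phi>\<close>, so no relation between the web
  functions beyond equality of their level sets is needed.\<close>

lemma flex_condition_web_mapping:
  assumes M: "smooth_surface M" and M': "smooth_surface M'" and diffeo: "diffeo_on M V \<phi> M'"
    and W: "web M d W" "leaves_geodesic M D d W" and i: "i \<in> {1..d}"
    and c: "c \<in> charts (restrict_surface M V)" "p \<in> fst c"
    and h: "submersion M' U' h" "\<phi> p \<in> U'"
    and level: "\<And>U f. (U, f) \<in> W i \<Longrightarrow> p \<in> U \<Longrightarrow>
      same_level_sets_near M {q \<in> N \<inter> U. \<phi> q \<in> U'} p f (h \<circ> \<phi>)"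
  shows "flex_condition (\<lambda>k i j. D c k i j (snd c p)) (coord (push_chart V \<phi> c) h) (snd c p)"
proof -
  let ?c = "push_chart V \<phi> c"
  note inj = diffeo_on_inj_on[OF diffeo]
  have cM: "c \<in> charts M" "fst c \<subseteq> V" using c(1) by (simp_all add: charts_restrict_surface)
  note chart = smooth_surface_is_chart[OF M cM(1)]
  have c': "?c \<in> charts M'" using push_chart_in_charts[OF M' diffeo cM(1) chart cM(2)] .
  note chart' = smooth_surface_is_chart[OF M' c']
  have "foliation M (W i)" using W(1) i by (simp add: web_def)
  from foliation_cover[OF M this cM(1) c(2)] obtain U f where f: "(U, f) \<in> W i" "p \<in> U" by blast
  obtain B where B: "openin (topo M) B" "p \<in> B" "B \<subseteq> {q \<in> N \<inter> U. \<phi> q \<in> U'}"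
    "\<forall>q\<in>B. \<forall>r\<in>B. f q = f r \<longleftrightarrow> h (\<phi> q) = h (\<phi> r)"
    using level[OF f] by (auto simp: same_level_sets_near_def)
  obtain \<epsilon> \<gamma> where \<gamma>: "\<epsilon> > 0" "geodesic M D {-\<epsilon><..<\<epsilon>} \<gamma>" "\<gamma> 0 = p"
    "\<forall>t\<in>{-\<epsilon><..<\<epsilon>}. \<gamma> t \<in> U \<and> f (\<gamma> t) = f p"
    using W(2) i f unfolding leaves_geodesic_def by blast
  show ?thesis
  proof (rule flex_condition_if_level_geodesic[OF \<gamma>(2,1) cM(1) chart _ B(1) _ submersionD(2)[OF h(1) c'],
        where k = "h (\<phi> p)"])
    fix t assume t: "t \<in> {-\<epsilon><..<\<epsilon>}" "\<gamma> t \<in> B" "\<gamma> t \<in> fst c"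
    have eq: "snd c (\<gamma> t) = snd ?c (\<phi> (\<gamma> t))"
      using t(3) cM(2) by (intro push_chart_apply[OF inj, symmetric]) auto
    have mem: "\<phi> (\<gamma> t) \<in> fst ?c" using t(3) by (simp add: push_chart_def)
    \<comment> \<open>Along the leaf \<open>f\<close> is constant, and inside \<open>B\<close> equal
      values of \<open>f\<close> mean equal values of the transported function.\<close>
    have "h (\<phi> (\<gamma> t)) = h (\<phi> p)" using B(2,4) \<gamma>(4) t by blast
    then show "snd c (\<gamma> t) \<in> snd ?c ` (fst ?c \<inter> U') \<and> coord ?c h (snd c (\<gamma> t)) = h (\<phi> p)"
      unfolding eq coord_apply[OF chart' mem] using mem B(3) t(2) by blast
  qed (use \<gamma>(3) c(2) B(2) in auto)
qed

theorem theorem20: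
  fixes M :: "'a surface" and g :: "'a metric_field" and D :: "'a conn"
    and W :: "nat \<Rightarrow> 'a fol" and d :: nat
    and M' :: "'b surface" and W' :: "nat \<Rightarrow> 'b fol"
    and N :: "'a set" and \<phi> :: "'a \<Rightarrow> 'b"
  assumes "smooth_surface M" and "riemannian_metric M g" and "levi_civita M g D"
    and "constant_curvature M g D"
    and "d \<ge> 4" and "web M d W" and "leaves_geodesic M D d W"
    and "web_invariants_vanish M d W"
    and "smooth_surface M'" and "geodesic_web M' d W'"
    and "web_mapping M W N \<phi> M' W' d"
  shows "projective_transformation M W N \<phi> M' W' d"
proof -
  note M = assms(1) and d = assms(5) and W = assms(6,7) and M' = assms(9)
  have D: "connection M D" using assms(3) by (simp add: levi_civita_def)
  obtain D' where W': "web M' d W'" and D': "connection M' D'" "leaves_geodesic M' D' d W'"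
    using assms(10) by (auto simp: geodesic_web_def)
  obtain \<sigma> where \<sigma>: "bij_betw \<sigma> {1..d} {1..d}"
    and "\<forall>i\<in>{1..d}. \<forall>(U, f)\<in>W i. \<forall>(U', h)\<in>W' (\<sigma> i). \<forall>p\<in>N \<inter> U. \<phi> p \<in> U' \<longrightarrow>
      same_level_sets_near M {q\<in>N \<inter> U. \<phi> q \<in> U'} p f (h \<circ> \<phi>)"
    using assms(11) unfolding web_mapping_def by (elim conjE exE)
  then have level: "\<And>i U f U' h p. i \<in> {1..d} \<Longrightarrow> (U, f) \<in> W i \<Longrightarrow> (U', h) \<in> W' (\<sigma> i) \<Longrightarrow>
      p \<in> N \<inter> U \<Longrightarrow> \<phi> p \<in> U' \<Longrightarrow> same_level_sets_near M {q\<in>N \<inter> U. \<phi> q \<in> U'} p f (h \<circ> \<phi>)"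
    by blast
  \<comment> \<open>\<open>E\<close> and \<open>E'\<close> are arbitrary members of the two classes,
    while geodesic leaves are known for \<open>D\<close> and \<open>D'\<close>. The latter are
    compared first, and the result is then carried along the classes.\<close>
  have "pullback V \<phi> E' \<in> proj_class (restrict_surface M V) E"
    if V: "V \<subseteq> N" and diffeo: "diffeo_on M V \<phi> M'" and E: "E \<in> proj_class M D" and E': "E' \<in> proj_class M' D'"
    for V E E'
  proof -
    let ?R = "restrict_surface M V"
    note inj = diffeo_on_inj_on[OF diffeo]
    have charts: "is_chart (topo M) c" "open (snd c ` fst c)" if "c \<in> charts ?R" for c
      using that smooth_surface_is_chart[OF M] smooth_surface_open[OF M]
      by (auto simp: charts_restrict_surface)
    have "proj_equivalent ?R D (pullback V \<phi> D')"
    proof (rule proj_equivalent_if_flex_conditions[OF charts(1) _ connection_restrict_surface[OF D]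
          connection_pullback[OF M M' diffeo D'(1)]])
      show "compatible c e" if "c \<in> charts ?R" "e \<in> charts ?R" for c e
        using M that by (simp add: smooth_surface_def charts_restrict_surface)
      fix c p assume c: "c \<in> charts ?R" "p \<in> fst c"
      let ?c = "push_chart V \<phi> c"
      have c': "?c \<in> charts M'" "\<phi> p \<in> fst ?c"
        using c push_chart_in_charts[OF M' diffeo _ charts(1)[OF c(1)]]
        by (auto simp: charts_restrict_surface push_chart_def)
      have pV: "p \<in> V" using c by (auto simp: charts_restrict_surface)
      then have eq: "snd ?c (\<phi> p) = snd c p" by (rule push_chart_apply[OF inj])
      have \<sigma>d: "\<sigma> i \<in> {1..d}" if "i \<in> {1..d}" for i
        using \<sigma> that by (auto simp: bij_betw_def)
      then have "\<forall>i\<in>{1..d}. \<exists>U h. (U, h) \<in> W' (\<sigma> i) \<and> \<phi> p \<in> U"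
        using foliation_cover[OF M' _ c'] W' by (simp add: web_def)
      then obtain U h where h: "\<And>i. i \<in> {1..d} \<Longrightarrow> (U i, h i) \<in> W' (\<sigma> i) \<and> \<phi> p \<in> U i"
        by metis
      show "\<exists>F. (\<forall>i\<in>{1..4::nat}. flex_condition (\<lambda>k i j. D c k i j (snd c p)) (F i) (snd c p) \<and>
             flex_condition (\<lambda>k i j. pullback V \<phi> D' c k i j (snd c p)) (F i) (snd c p)) \<and>
          (\<forall>i\<in>{1..4}. \<forall>j\<in>{1..4}. i \<noteq> j \<longrightarrow>
             pd 1 (F i) (snd c p) * pd 2 (F j) (snd c p)
             - pd 2 (F i) (snd c p) * pd 1 (F j) (snd c p) \<noteq> 0)"
      \<comment> \<open>The target web functions in the transported chart serve both connections:
        \<open>D\<close> because the mapping sends its leaves into their level sets, the pullback of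
        \<open>D'\<close> because their level sets are leaves on the target.\<close>
      proof (intro exI[of _ "\<lambda>i. coord ?c (h i)"] conjI ballI impI)
        fix i :: nat assume "i \<in> {1..4}"
        then have i: "i \<in> {1..d}" using d by simp
        note hi = h[OF i, THEN conjunct1] h[OF i, THEN conjunct2]
        have "foliation M' (W' (\<sigma> i))" using W' \<sigma>d[OF i] by (simp add: web_def)
        then have "submersion M' (U i) (h i)" using hi(1) by (rule foliation_submersion)
        then show "flex_condition (\<lambda>k i j. D c k i j (snd c p)) (coord ?c (h i)) (snd c p)"
          using hi(2) level[OF i _ hi(1) _ hi(2)] pV V
          by (intro flex_condition_web_mapping[OF M M' diffeo W i c, where N = N]) auto
        show "flex_condition (\<lambda>k i j. pullback V \<phi> D' c k i j (snd c p)) (coord ?c (h i)) (snd c p)"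
          using flex_condition_leaf[OF M' W' D'(2) \<sigma>d[OF i] hi c'] by (simp add: eq pullback_eq)
        fix j assume "j \<in> {1..4::nat}" and "i \<noteq> j"
        then have j: "j \<in> {1..d}" using d by simp
        \<comment> \<open>Foliations may be permuted, but distinct ones stay distinct, so
          transversality in the target web applies.\<close>
        have "\<sigma> i \<noteq> \<sigma> j" using \<sigma> i j \<open>i \<noteq> j\<close> by (auto simp: bij_betw_def dest: inj_onD)
        note hj = h[OF j, THEN conjunct1] h[OF j, THEN conjunct2]
        from \<open>\<sigma> i \<noteq> \<sigma> j\<close>
        show "pd 1 (coord ?c (h i)) (snd c p) * pd 2 (coord ?c (h j)) (snd c p) -
            pd 2 (coord ?c (h i)) (snd c p) * pd 1 (coord ?c (h j)) (snd c p) \<noteq> 0"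
          using web_independent[OF W' \<sigma>d[OF i] \<sigma>d[OF j] _ hi(1) hj(1) c' hi(2) hj(2)]
          unfolding eq by blast
      qed
    qed
    moreover have "proj_equivalent ?R D E"
      using E by (intro proj_equivalent_restrict_surface) (simp add: proj_class_def)
    \<comment> \<open>The chain runs from \<open>E\<close> through \<open>D\<close> and the pullback
      of \<open>D'\<close> to the pullback of \<open>E'\<close>, all on the restricted
      surface.\<close>
    ultimately have "proj_equivalent ?R E (pullback V \<phi> D')"
      using charts(2) proj_equivalent_euclidean by metis
    moreover have "proj_equivalent ?R (pullback V \<phi> D') (pullback V \<phi> E')"
      using E' by (intro proj_equivalent_pullback[OF M M' diffeo]) (simp add: proj_class_def)
    ultimately have "proj_equivalent ?R E (pullback V \<phi> E')"
      using proj_equivalent_trans[OF charts(2)] by blast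
    moreover have "connection ?R (pullback V \<phi> E')"
      using E' by (intro connection_pullback[OF M M' diffeo]) (simp add: proj_class_def)
    ultimately show ?thesis by (simp add: proj_class_def)
  qed
  then show ?thesis
    unfolding projective_transformation_def carries_projective_structure_def
      web_projective_structure_eq[OF M d W(1) D W(2)] web_projective_structure_eq[OF M' d W' D']
    by blast
qed

end
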